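(* Let $a$, $b$ and $c$ be real numbers with $0<a\le b$ and $a+b+\tfrac12\le c\le 1+a$. Then the order of convexity of $w(z)={}_2F_1(a+1,b;c;z)/{}_2F_1(a,b;c;z)$ satisfies $$\kappa[a,b,c]\ \ge\ \frac{3a-b-c}{2}+\frac{b-a}{1+a+b-c}+\frac{ac\,[2(c-a-b)-1]}{(b+c)(1+a+b-c)}.$$
   Context: $\mathbb{D}=\{z\in\mathbb{C}:|z|<1\}$. The Gaussian hypergeometric function is ${}_2F_1(a,b;c;z)=\sum_{n\ge0}\frac{(a)_n(b)_n}{(c)_n\,n!}z^n$ for $z\in\mathbb{D}$, where $(a)_0=1$, $(a)_n=a(a+1)\cdots(a+n-1)$, and $c\notin\{0,-1,-2,\dots\}$. For a non-constant holomorphic function $f$ on $\mathbb{D}$, the order of convexity is $\kappa(f)=1+\inf_{z\in\mathbb{D}}\operatorname{Re}\frac{zf''(z)}{f'(z)}\in[-\infty,1]$. We write $\kappa[a,b,c]=\kappa(w_{a,b,c})$, where $w_{a,b,c}(z)=\dfrac{{}_2F_1(a+1,b;c;z)}{{}_2F_1(a,b;c;z)}$ for $z\in\mathbb{D}$. *)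

theory Defs
  imports "HOL-Complex_Analysis.Complex_Analysis"
begin

definition hyp2F1 :: "complex \<Rightarrow> complex \<Rightarrow> complex \<Rightarrow> complex \<Rightarrow> complex" where
  "hyp2F1 a b c z =
     (\<Sum>n. pochhammer a n * pochhammer b n / (pochhammer c n * fact n) * z ^ n)"

lemma hyp2F1_eq_eval_fps_hypergeo:
  "hyp2F1 a b c z = eval_fps (fps_hypergeo [a, b] [c] 1) z"
  by (simp add: hyp2F1_def eval_fps_def)

(* Meant for non-constant f holomorphic on the unit disc. The infimum is taken in the
   extended reals, so that it is minus infinity when the real part is unbounded below.
   The convention x / 0 = 0 at zeros of f' is harmless: at a zero z0 \<noteq> 0 of f' the
   quotient has a simple pole, so the infimum is minus infinity whatever value is put at z0.
   At z = 0 the term is always 0 (also when f' vanishes there), whence the value is \<le> 1. *)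
definition order_of_convexity :: "(complex \<Rightarrow> complex) \<Rightarrow> ereal" where
  "order_of_convexity f =
     1 + (INF z \<in> ball 0 1. ereal (Re (z * (deriv ^^ 2) f z / deriv f z)))"

definition hyp_ratio :: "real \<Rightarrow> real \<Rightarrow> real \<Rightarrow> complex \<Rightarrow> complex" where
  "hyp_ratio a b c z =
     hyp2F1 (of_real (a + 1)) (of_real b) (of_real c) z /
     hyp2F1 (of_real a) (of_real b) (of_real c) z"

definition hyp_ratio_convexity :: "real \<Rightarrow> real \<Rightarrow> real \<Rightarrow> ereal" where
  "hyp_ratio_convexity a b c = order_of_convexity (hyp_ratio a b c)"

end

(* Put F = 2F1(a,b;c), G = 2F1(a+1,b;c), N = 1+a+b-c and d = 1+a-c. Gauss's contiguous relations
   give w = G/F = 1/(1 - z h), where h is a continued fraction q_0 of Wall's form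
   q_k = g_k / (1 - (1 - g_k) z q_(k+1)) with all g_k in (0,1]. With v = (1-z) w h and
   u = b - a v + d h one has (1-z) w' = w u, and the Riccati equation of w yields
     1 + z w''/w' = A/u - 2 a w + a - b - 1 + (N+1)/(1-z),   A = a w + b - a.
   Write u = N (1-m), where m = (a v + d (1-h))/N. The values v, h and hence m lie in the disc
   |x - 1/2| <= 1/2, since N is the sum of the nonnegative weights a, d and b - a (the last one
   at 0). If Im z >= 0, then Im m <= 0 and A lies in the closed first quadrant, so that
   A/u - A/N = (A/N) m/(1-m) has nonnegative real part. The bound follows from Re w >= c/(b+c),
   Re 1/(1-z) >= 1/2 and 1 - 2N >= 0. *)

theory Submission
  imports Defs "HOL-Real_Asymp.Real_Asymp"
begin

text \<open>Discs alone do not suffice: \<open>Re (A * m / (1 - m)) >= 0\<close> needs opposite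
  quadrants for the two factors, hence the signs of \<open>Im w\<close>, \<open>Im h\<close> and
  \<open>Im v\<close> together. The sign of \<open>Im v\<close> is not visible from
  \<open>h\<close>; it comes from the next tail \<open>q_1\<close>. This forces a region for all
  tails that constrains both \<open>q\<close> and \<open>(1 - z q) / (1 - z)\<close>. It is closed,
  contains 0 and is preserved by every step of the fraction, so convergence of the finite
  truncations takes the place of an integral representation. The lower half-plane follows by
  conjugation. The fraction lives in formal power series. A bound on coefficient sums makes
  \<open>h\<close> holomorphic in the disc before anything is known about zeros of G; then
  \<open>(1 - z) G' = (b + d h) G\<close> excludes zeros of G, and \<open>|z h| < 1\<close> those of
  F. In the final sum \<open>w\<close> has the coefficient \<open>a/N - 2a = a (1 - 2N) / N\<close>.
  Its sign is the role of \<open>a + b + 1/2 <= c\<close>, while \<open>c <= 1 + a\<close> means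
  \<open>d >= 0\<close>. The constant \<open>c / (b + c)\<close> is \<open>1 / (1 + g_0)\<close>
  with \<open>g_0 = b / c\<close>.\<close>

section \<open>Wall's g-fractions\<close>

text \<open>The equation is \<open>q k = g k / (1 - (1 - g k) z q (k+1))\<close> cleared of its
  denominator. It yields coefficient \<open>n + 1\<close> of \<open>q k\<close> from coefficients up
  to \<open>n\<close> of \<open>q k\<close> and \<open>q (Suc k)\<close>, so no convergence is
  presupposed.\<close>

definition g_fraction :: "(nat \<Rightarrow> real) \<Rightarrow> (nat \<Rightarrow> complex fps) \<Rightarrow> bool" where
  "g_fraction g q \<longleftrightarrow> (\<forall>k. 0 \<le> g k \<and> g k \<le> 1 \<and>
     q k = fps_const (of_real (g k)) + fps_const (of_real (1 - g k)) * (fps_X * (q k * q (Suc k))))"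

lemma g_fractionD:
  assumes "g_fraction g q"
  shows "0 \<le> g k" "g k \<le> 1"
    and "q k = fps_const (of_real (g k)) + fps_const (of_real (1 - g k)) * (fps_X * (q k * q (Suc k)))"
  using assms unfolding g_fraction_def by blast+

lemma g_fraction_nth_0:
  assumes "g_fraction g q"
  shows "fps_nth (q k) 0 = of_real (g k)"
  by (subst g_fractionD(3)[OF assms]) simp

lemma g_fraction_nth_Suc:
  assumes "g_fraction g q"
  shows "fps_nth (q k) (Suc n) =
    of_real (1 - g k) * (\<Sum>i\<le>n. fps_nth (q k) i * fps_nth (q (Suc k)) (n - i))"
  by (subst g_fractionD(3)[OF assms]) (simp add: fps_mult_nth[of "q k"] atLeast0AtMost)

text \<open>The left side runs over the triangle \<open>i + j <= n\<close> inside the square on the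
  right.\<close>

lemma sum_cauchy_product_le:
  fixes f g :: "nat \<Rightarrow> real"
  assumes "\<And>n. 0 \<le> f n" and "\<And>n. 0 \<le> g n"
  shows "(\<Sum>m\<le>n. \<Sum>i\<le>m. f i * g (m - i)) \<le> (\<Sum>i\<le>n. f i) * (\<Sum>j\<le>n. g j)"
proof -
  have "(\<Sum>m\<le>n. \<Sum>i\<le>m. f i * g (m - i)) = (\<Sum>(i, j)\<in>{(i, j). i + j \<le> n}. f i * g j)"
    by (rule sum.triangle_reindex_eq[symmetric])
  also have "\<dots> \<le> (\<Sum>(i, j)\<in>{..n} \<times> {..n}. f i * g j)"
    by (rule sum_mono2) (use assms in auto)
  also have "\<dots> = (\<Sum>i\<le>n. f i) * (\<Sum>j\<le>n. g j)"
    by (simp add: sum_product sum.cartesian_product)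
  finally show ?thesis .
qed

text \<open>Writing \<open>S k n\<close> for the sum, the recurrence gives
  \<open>S k (n+1) <= g k + (1 - g k) * S k n * S (k+1) n\<close>, which is at most 1 by induction
  on \<open>n\<close> for all \<open>k\<close> at once. Both convergence in the disc and
  \<open>norm (q k) <= 1\<close> there rest on this estimate.\<close>

lemma g_fraction_sum_norm_le:
  assumes "g_fraction g q"
  shows "(\<Sum>i\<le>n. norm (fps_nth (q k) i)) \<le> 1"
proof (induction n arbitrary: k)
  case 0
  show ?case
    using g_fractionD(1,2)[OF assms, of k] by (simp add: g_fraction_nth_0[OF assms])
next
  case (Suc n)
  let ?c = "\<lambda>k i. norm (fps_nth (q k) i)"
  have g: "0 \<le> g k" "g k \<le> 1"
    by (rule g_fractionD[OF assms])+
  have "(\<Sum>i\<le>Suc n. ?c k i) = g k + (\<Sum>m\<le>n. ?c k (Suc m))"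
    using g by (simp only: sum.atMost_Suc_shift) (simp add: g_fraction_nth_0[OF assms])
  also have "\<dots> \<le> g k + (\<Sum>m\<le>n. (1 - g k) * (\<Sum>i\<le>m. ?c k i * ?c (Suc k) (m - i)))"
  proof (intro add_left_mono sum_mono)
    fix m
    have "?c k (Suc m) =
        (1 - g k) * norm (\<Sum>i\<le>m. fps_nth (q k) i * fps_nth (q (Suc k)) (m - i))"
      using g by (simp only: g_fraction_nth_Suc[OF assms] norm_mult norm_of_real)
    also have "\<dots> \<le> (1 - g k) * (\<Sum>i\<le>m. ?c k i * ?c (Suc k) (m - i))"
      using g by (intro mult_left_mono sum_norm_le) (auto simp: norm_mult)
    finally show "?c k (Suc m) \<le> (1 - g k) * (\<Sum>i\<le>m. ?c k i * ?c (Suc k) (m - i))" .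
  qed
  also have "\<dots> = g k + (1 - g k) * (\<Sum>m\<le>n. \<Sum>i\<le>m. ?c k i * ?c (Suc k) (m - i))"
    by (simp add: sum_distrib_left)
  also have "\<dots> \<le> g k + (1 - g k) * ((\<Sum>i\<le>n. ?c k i) * (\<Sum>j\<le>n. ?c (Suc k) j))"
    using g by (intro add_left_mono mult_left_mono sum_cauchy_product_le) auto
  also have "\<dots> \<le> g k + (1 - g k) * (1 * 1)"
    using g by (intro add_left_mono mult_left_mono mult_mono Suc.IH) (auto intro: sum_nonneg)
  finally show ?case by simp
qed

lemma g_fraction_summable_norm:
  assumes "g_fraction g q"
  shows "summable (\<lambda>n. norm (fps_nth (q k) n))"
proof (rule summableI_nonneg_bounded)
  fix n
  show "(\<Sum>i<n. norm (fps_nth (q k) i)) \<le> 1"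
    by (rule order.trans[OF sum_mono2 g_fraction_sum_norm_le[OF assms, of k n]]) auto
qed simp

lemma g_fraction_suminf_norm_le:
  assumes "g_fraction g q"
  shows "(\<Sum>n. norm (fps_nth (q k) n)) \<le> 1"
proof (rule suminf_le_const[OF g_fraction_summable_norm[OF assms]])
  fix n
  show "(\<Sum>i<n. norm (fps_nth (q k) i)) \<le> 1"
    by (rule order.trans[OF sum_mono2 g_fraction_sum_norm_le[OF assms, of k n]]) auto
qed

lemma g_fraction_conv_radius:
  assumes "g_fraction g q"
  shows "fps_conv_radius (q k) \<ge> 1"
proof -
  have "ereal (norm (1 :: complex)) \<le> fps_conv_radius (q k)"
    unfolding fps_conv_radius_def
    by (rule conv_radius_geI)
       (use summable_norm_cancel[OF g_fraction_summable_norm[OF assms]] in simp)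
  then show ?thesis
    by (simp add: one_ereal_def)
qed

lemma less_fps_conv_radius:
  assumes "fps_conv_radius f \<ge> 1" and "norm z < 1"
  shows "ereal (norm z) < fps_conv_radius f"
  by (rule less_le_trans[OF _ assms(1)]) (use assms(2) in \<open>simp add: one_ereal_def\<close>)

lemma less_fps_conv_radius_mult:
  fixes f g :: "'a :: {banach, real_normed_div_algebra} fps"
  assumes "r < fps_conv_radius f" and "r < fps_conv_radius g"
  shows "r < fps_conv_radius (f * g)"
  by (rule less_le_trans[OF _ fps_conv_radius_mult]) (use assms in simp)

lemma g_fraction_eval_eq:
  assumes "g_fraction g q" and z: "norm z < 1"
  shows "eval_fps (q k) z =
    of_real (g k) + of_real (1 - g k) * z * eval_fps (q k) z * eval_fps (q (Suc k)) z"
proof -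
  note r = less_fps_conv_radius[OF g_fraction_conv_radius[OF assms(1)] z]
  have qq: "ereal (norm z) < fps_conv_radius (q k * q (Suc k))"
    by (intro less_fps_conv_radius_mult r)
  have X: "ereal (norm z) < fps_conv_radius (fps_X * (q k * q (Suc k)))"
    by (rule less_fps_conv_radius_mult[OF _ qq]) simp
  have cX: "ereal (norm z) <
      fps_conv_radius (fps_const (of_real (1 - g k)) * (fps_X * (q k * q (Suc k))))"
    by (rule less_fps_conv_radius_mult[OF _ X]) simp
  have "eval_fps (q k) z =
      eval_fps (fps_const (of_real (g k)) + fps_const (of_real (1 - g k)) * (fps_X * (q k * q (Suc k)))) z"
    using g_fractionD(3)[OF assms(1), of k] by (simp add: mult.assoc)
  then show ?thesis
    using r[of k] r[of "Suc k"] X qq cX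
    by (simp add: eval_fps_add eval_fps_mult mult.assoc)
qed

lemma g_fraction_eval_norm_le:
  assumes "g_fraction g q" and "norm z < 1"
  shows "norm (eval_fps (q k) z) \<le> 1"
proof -
  have le: "norm (fps_nth (q k) n * z ^ n) \<le> norm (fps_nth (q k) n)" for n
    using assms(2) by (simp add: norm_mult norm_power mult_left_le power_le_one)
  have sm: "summable (\<lambda>n. norm (fps_nth (q k) n * z ^ n))"
    by (rule summable_comparison_test'[OF g_fraction_summable_norm[OF assms(1)]]) (use le in auto)
  have "norm (eval_fps (q k) z) \<le> (\<Sum>n. norm (fps_nth (q k) n * z ^ n))"
    unfolding eval_fps_def by (rule summable_norm[OF sm])
  also have "\<dots> \<le> (\<Sum>n. norm (fps_nth (q k) n))"
    by (intro suminf_le le sm g_fraction_summable_norm[OF assms(1)])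
  also have "\<dots> \<le> 1"
    by (rule g_fraction_suminf_norm_le[OF assms(1)])
  finally show ?thesis .
qed

section \<open>Truncated fractions and their convergence\<close>

fun g_fraction_trunc :: "(nat \<Rightarrow> real) \<Rightarrow> nat \<Rightarrow> nat \<Rightarrow> complex fps" where
  "g_fraction_trunc g 0 k = 0"
| "g_fraction_trunc g (Suc n) k = fps_const (of_real (g k)) *
     inverse (1 - fps_const (of_real (1 - g k)) * (fps_X * g_fraction_trunc g n (Suc k)))"

text \<open>The denominator has constant term 1, so the formal inverse is a true one and the
  quotient satisfies the same equation as a g-fraction.\<close>

lemma g_fraction_trunc_Suc:
  "g_fraction_trunc g (Suc n) k = fps_const (of_real (g k)) +
     fps_const (of_real (1 - g k)) *
       (fps_X * (g_fraction_trunc g (Suc n) k * g_fraction_trunc g n (Suc k)))"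
proof -
  let ?D = "1 - fps_const (of_real (1 - g k)) * (fps_X * g_fraction_trunc g n (Suc k)) :: complex fps"
  have "inverse ?D * ?D = 1"
    by (rule inverse_mult_eq_1) simp
  then have "g_fraction_trunc g (Suc n) k * ?D = fps_const (of_real (g k))"
    by (simp add: mult.assoc)
  then show ?thesis
    by (simp add: algebra_simps del: g_fraction_trunc.simps)
qed

text \<open>A truncated fraction is again a g-fraction, with all parameters from the cut on equal to 0.\<close>

lemma g_fraction_g_fraction_trunc:
  assumes "\<And>k. 0 \<le> g k" and "\<And>k. g k \<le> 1"
  shows "g_fraction (\<lambda>j. if j < n then g (k + j) else 0) (\<lambda>j. g_fraction_trunc g (n - j) (k + j))"
  unfolding g_fraction_def
proof (intro allI conjI)
  fix j
  let ?g = "\<lambda>j. if j < n then g (k + j) else 0"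
  let ?t = "\<lambda>j. g_fraction_trunc g (n - j) (k + j)"
  show "?t j = fps_const (of_real (?g j)) + fps_const (of_real (1 - ?g j)) * (fps_X * (?t j * ?t (Suc j)))"
  proof (cases "j < n")
    case True
    then have n: "n - j = Suc (n - Suc j)"
      by simp
    show ?thesis
      unfolding n using True g_fraction_trunc_Suc[of g "n - Suc j" "k + j"] by simp
  qed simp
qed (use assms in auto)

text \<open>Each level puts a factor \<open>fps_X\<close> before the tail, so cutting after
  \<open>n\<close> levels affects only degrees from \<open>n\<close> on. Coefficient
  \<open>m\<close> also involves lower coefficients of the same truncation, hence the strong
  induction on \<open>m\<close> inside the one on \<open>n\<close>.\<close>

lemma g_fraction_trunc_nth:
  assumes "g_fraction g q" and "m < n"
  shows "fps_nth (g_fraction_trunc g n k) m = fps_nth (q k) m"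
  using assms(2)
proof (induction n arbitrary: k m)
  case (Suc n)
  let ?t = "g_fraction_trunc g (Suc n) k" and ?t' = "g_fraction_trunc g n (Suc k)"
  from \<open>m < Suc n\<close> show ?case
  proof (induction m rule: less_induct)
    case (less m)
    show ?case
    proof (cases m)
      case 0
      show ?thesis
        unfolding 0
        by (subst g_fraction_trunc_Suc, subst g_fraction_nth_0[OF assms(1)])
           (simp del: g_fraction_trunc.simps)
    next
      case (Suc l)
      have "fps_nth ?t m = of_real (1 - g k) * (\<Sum>i\<le>l. fps_nth ?t i * fps_nth ?t' (l - i))"
        by (subst g_fraction_trunc_Suc)
           (simp add: Suc fps_mult_nth[of ?t] atLeast0AtMost del: g_fraction_trunc.simps)
      also have "\<dots> = of_real (1 - g k) * (\<Sum>i\<le>l. fps_nth (q k) i * fps_nth (q (Suc k)) (l - i))"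
        using less Suc Suc.IH
        by (intro arg_cong2[of _ _ _ _ "(*)"] refl sum.cong) (simp_all del: g_fraction_trunc.simps)
      also have "\<dots> = fps_nth (q k) m"
        by (simp add: Suc g_fraction_nth_Suc[OF assms(1)])
      finally show ?thesis .
    qed
  qed
qed simp

lemma g_fraction_trunc_eval:
  assumes "\<And>k. 0 \<le> g k" and "\<And>k. g k \<le> 1" and z: "norm z < 1"
  shows "norm (eval_fps (g_fraction_trunc g n k) z) \<le> 1"
    and "eval_fps (g_fraction_trunc g (Suc n) k) z = of_real (g k) /
      (1 - of_real (1 - g k) * z * eval_fps (g_fraction_trunc g n (Suc k)) z)"
proof -
  note tr = g_fraction_g_fraction_trunc[of g, OF assms(1,2)]
  show norm_le: "norm (eval_fps (g_fraction_trunc g n k) z) \<le> 1" for n k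
    using g_fraction_eval_norm_le[OF tr[of n k] z, of 0] by simp
  let ?T = "eval_fps (g_fraction_trunc g (Suc n) k) z"
  let ?T' = "eval_fps (g_fraction_trunc g n (Suc k)) z"
  have eq: "?T = of_real (g k) + of_real (1 - g k) * z * ?T * ?T'"
    using g_fraction_eval_eq[OF tr[of "Suc n" k] z, of 0] by (simp del: g_fraction_trunc.simps)
  have "norm (of_real (1 - g k) * z * ?T') = (1 - g k) * norm z * norm ?T'"
    using assms(2)[of k] by (simp only: norm_mult norm_of_real)
  also have "\<dots> \<le> 1 * norm z * 1"
    using assms(1,2)[of k] norm_le by (intro mult_mono) auto
  also have "\<dots> < 1"
    using z by simp
  finally have "1 - of_real (1 - g k) * z * ?T' \<noteq> 0"
    by auto
  then show "?T = of_real (g k) / (1 - of_real (1 - g k) * z * ?T')"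
    using eq by (simp add: field_simps del: g_fraction_trunc.simps)
qed

text \<open>The difference starts in degree \<open>n\<close>, and its coefficients have total norm
  at most 2, one from each series; hence the error bound \<open>2 * norm z ^ n\<close>.\<close>

lemma g_fraction_trunc_tendsto:
  assumes "g_fraction g q" and z: "norm z < 1"
  shows "(\<lambda>n. eval_fps (g_fraction_trunc g n k) z) \<longlonglongrightarrow> eval_fps (q k) z"
proof (rule LIM_zero_cancel, rule Lim_null_comparison)
  show "(\<lambda>n. 2 * norm z ^ n) \<longlonglongrightarrow> 0"
    using z by (intro tendsto_mult_right_zero LIMSEQ_realpow_zero) auto
  show "\<forall>\<^sub>F n in sequentially.
      norm (eval_fps (g_fraction_trunc g n k) z - eval_fps (q k) z) \<le> 2 * norm z ^ n"
  proof (intro always_eventually allI)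
    fix n
    let ?t = "g_fraction_trunc g n k"
    have tr: "g_fraction (\<lambda>j. if j < n then g (k + j) else 0) (\<lambda>j. g_fraction_trunc g (n - j) (k + j))"
      by (intro g_fraction_g_fraction_trunc g_fractionD[OF assms(1)])
    have st: "summable (\<lambda>m. norm (fps_nth ?t m))" "(\<Sum>m. norm (fps_nth ?t m)) \<le> 1"
      using g_fraction_summable_norm[OF tr, of 0] g_fraction_suminf_norm_le[OF tr, of 0] by simp_all
    note sq = g_fraction_summable_norm[OF assms(1), of k] g_fraction_suminf_norm_le[OF assms(1), of k]
    have rt: "ereal (norm z) < fps_conv_radius ?t"
      using less_fps_conv_radius[OF g_fraction_conv_radius[OF tr, of 0] z] by simp
    have rq: "ereal (norm z) < fps_conv_radius (q k)"
      by (rule less_fps_conv_radius[OF g_fraction_conv_radius[OF assms(1)] z])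
    let ?d = "\<lambda>m. norm (fps_nth ?t m) + norm (fps_nth (q k) m)"
    have le: "norm (fps_nth (?t - q k) m * z ^ m) \<le> norm z ^ n * ?d m" for m
    proof (cases "m < n")
      case True
      then show ?thesis
        by (simp add: g_fraction_trunc_nth[OF assms(1)])
    next
      case False
      have "norm (fps_nth (?t - q k) m * z ^ m) \<le> ?d m * norm z ^ n"
        unfolding norm_mult norm_power
        using z False by (intro mult_mono power_decreasing) (auto intro: norm_triangle_ineq4)
      then show ?thesis
        by (simp add: mult.commute)
    qed
    have sd: "summable (\<lambda>m. norm z ^ n * ?d m)"
      by (intro summable_mult summable_add st sq)
    have s: "summable (\<lambda>m. norm (fps_nth (?t - q k) m * z ^ m))"
      by (rule summable_comparison_test'[OF sd]) (use le in auto)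
    have "norm (eval_fps ?t z - eval_fps (q k) z) = norm (eval_fps (?t - q k) z)"
      by (simp add: eval_fps_diff rt rq)
    also have "\<dots> \<le> (\<Sum>m. norm (fps_nth (?t - q k) m * z ^ m))"
      unfolding eval_fps_def by (rule summable_norm[OF s])
    also have "\<dots> \<le> (\<Sum>m. norm z ^ n * ?d m)"
      by (intro suminf_le le s sd)
    also have "\<dots> = norm z ^ n * ((\<Sum>m. norm (fps_nth ?t m)) + (\<Sum>m. norm (fps_nth (q k) m)))"
      by (simp add: suminf_mult summable_add suminf_add st sq)
    also have "\<dots> \<le> norm z ^ n * 2"
      using st sq by (intro mult_left_mono) auto
    finally show "norm (eval_fps ?t z - eval_fps (q k) z) \<le> 2 * norm z ^ n"
      by (simp add: mult.commute)
  qed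
qed

section \<open>Half-planes and the disc with diameter [0, 1] under inversion\<close>

lemma Im_inverse_le_0_iff: "Im (inverse x) \<le> 0 \<longleftrightarrow> 0 \<le> Im x"
proof (cases "x = 0")
  case False
  then have "(Re x)\<^sup>2 + (Im x)\<^sup>2 > 0"
    by (simp add: complex_neq_0)
  then show ?thesis
    by (simp add: divide_le_0_iff zero_le_divide_iff)
qed simp

lemma Re_inverse_ge_0_iff: "0 \<le> Re (inverse x) \<longleftrightarrow> 0 \<le> Re x"
proof (cases "x = 0")
  case False
  then have "(Re x)\<^sup>2 + (Im x)\<^sup>2 > 0"
    by (simp add: complex_neq_0)
  then show ?thesis
    by (simp add: zero_le_divide_iff)
qed simp

lemma Im_of_real_mult: "Im (of_real r * x) = r * Im x"
  by simp

lemma Re_pos_imp_nonzero: "0 < Re x \<Longrightarrow> x \<noteq> 0"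
  by auto

text \<open>Inversion carries the half-plane \<open>Re >= 1\<close> onto the disc with diameter
  [0, 1] without its point 0; \<open>norm_power2_le_Re_iff\<close> rewrites that disc by centre and
  radius.\<close>

lemma Re_inverse_ge_1_iff:
  assumes "x \<noteq> 0"
  shows "1 \<le> Re (inverse x) \<longleftrightarrow> (norm x)\<^sup>2 \<le> Re x"
proof -
  have "(Re x)\<^sup>2 + (Im x)\<^sup>2 > 0"
    using assms by (simp add: complex_neq_0)
  then show ?thesis
    by (simp add: cmod_power2 le_divide_eq)
qed

lemma norm_power2_le_Re_iff: "(norm x)\<^sup>2 \<le> Re x \<longleftrightarrow> norm (x - 1/2) \<le> 1/2"
proof -
  have "(norm (x - 1/2))\<^sup>2 = (norm x)\<^sup>2 - Re x + (1/2)\<^sup>2"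
    unfolding cmod_power2 by (simp add: power2_eq_square algebra_simps)
  moreover have "norm (x - 1/2) \<le> 1/2 \<longleftrightarrow> (norm (x - 1/2))\<^sup>2 \<le> (1/2)\<^sup>2"
    by (rule power_mono_iff[symmetric]) auto
  ultimately show ?thesis
    by linarith
qed

lemma norm_power2_le_Re_imp_norm_le:
  assumes "(norm x)\<^sup>2 \<le> Re x"
  shows "norm x \<le> 1"
  using norm_triangle_ineq[of "x - 1/2" "1/2"] assms unfolding norm_power2_le_Re_iff by simp

section \<open>Value region of a g-fraction\<close>

text \<open>All functions \<open>\<integral> (1 - t) / (1 - t z) d\<sigma>(t)\<close> with a subprobability measure \<open>\<sigma>\<close> on \<open>[0, 1]\<close>
  take values in this region if \<open>Im z \<ge> 0\<close>. The conditions on \<open>(1 - z q) / (1 - z)\<close> are the ones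
  that make the region invariant under the continued fraction step; the first of them, at \<open>q_1\<close>, confines
  \<open>v\<close> to the disc \<open>\<bar>x - 1/2\<bar> \<le> 1/2\<close>.\<close>

definition g_region :: "complex \<Rightarrow> complex set" where
  "g_region z = {q. norm q \<le> 1 \<and> 0 \<le> Im q \<and> 0 \<le> Im (z * q) \<and>
     0 \<le> Re ((1 - z * q) / (1 - z)) \<and> 0 \<le> Im ((1 - z * q) / (1 - z)) \<and>
     0 \<le> Im (z * ((1 - z * q) / (1 - z)))}"

lemma closed_g_region: "closed (g_region z)"
proof -
  have "g_region z = {q. norm q \<le> 1} \<inter> {q. 0 \<le> Im q} \<inter> {q. 0 \<le> Im (z * q)} \<inter>
     {q. 0 \<le> Re ((1 - z * q) * inverse (1 - z))} \<inter> {q. 0 \<le> Im ((1 - z * q) * inverse (1 - z))} \<inter>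
     {q. 0 \<le> Im (z * ((1 - z * q) * inverse (1 - z)))}"
    by (auto simp: g_region_def divide_inverse)
  also have "closed \<dots>"
    by (intro closed_Int closed_Collect_le continuous_intros)
  finally show ?thesis .
qed

lemma Im_mult_inverse_one_minus:
  assumes "0 \<le> Im z"
  shows "0 \<le> Im (z * inverse (1 - z))"
proof (cases "z = 0 \<or> z = 1")
  case False
  then have "inverse (z * inverse (1 - z)) = inverse z - 1"
    by (simp add: field_simps)
  then have "Im (inverse (z * inverse (1 - z))) \<le> 0"
    using assms Im_inverse_le_0_iff[of z] by simp
  then show ?thesis
    by (simp only: Im_inverse_le_0_iff)
qed auto

lemma zero_in_g_region:
  assumes "norm z < 1" and "0 \<le> Im z"
  shows "0 \<in> g_region z"
proof -
  have "0 \<le> Re (inverse (1 - z))"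
    unfolding Re_inverse_ge_0_iff using complex_Re_le_cmod[of z] assms(1) by simp
  moreover have "0 \<le> Im (inverse (1 - z))"
    using Im_inverse_le_0_iff[of "inverse (1 - z)"] assms(2) by simp
  ultimately show ?thesis
    using Im_mult_inverse_one_minus[OF assms(2)] by (simp add: g_region_def divide_inverse)
qed

lemma norm_g_denom_ge:
  assumes "norm z < 1" and "norm q \<le> 1" and "g \<le> 1"
  shows "g \<le> Re (1 - of_real (1 - g) * z * q)"
proof -
  have "Re (of_real (1 - g) * z * q) \<le> norm (of_real (1 - g) * z * q)"
    by (rule complex_Re_le_cmod)
  also have "\<dots> = (1 - g) * (norm z * norm q)"
    using assms(3) by (simp only: norm_mult norm_of_real)
  also have "\<dots> \<le> (1 - g) * (1 * 1)"
    using assms by (intro mult_left_mono mult_mono) auto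
  finally show ?thesis by simp
qed

text \<open>The reciprocal \<open>D / g\<close> has real part at least 1, since
  \<open>|(1 - g) z q| <= 1 - g\<close>.\<close>

lemma g_step_norm_power2_le_Re:
  assumes "norm z < 1" and "norm q \<le> 1" and "0 < g" and "g \<le> 1"
  shows "(norm (of_real g / (1 - of_real (1 - g) * z * q)))\<^sup>2 \<le>
    Re (of_real g / (1 - of_real (1 - g) * z * q))"
proof -
  let ?D = "1 - of_real (1 - g) * z * q"
  have D: "g \<le> Re ?D"
    by (rule norm_g_denom_ge) (use assms in auto)
  have "1 \<le> Re ?D / g"
    using D assms(3) by simp
  also have "Re ?D / g = Re (?D / of_real g)"
    by (simp only: Re_divide_of_real)
  also have "?D / of_real g = inverse (of_real g / ?D)"
    by simp
  finally have "1 \<le> Re (inverse (of_real g / ?D))" .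
  moreover have "?D \<noteq> 0"
    by (rule Re_pos_imp_nonzero) (rule less_le_trans[OF assms(3) D])
  ultimately show ?thesis
    using Re_inverse_ge_1_iff[of "of_real g / ?D"] assms(3) by simp
qed

text \<open>In the coordinate \<open>Y = (1 - z q) / (1 - z)\<close> a step becomes
  \<open>Y -> E / D\<close>, where \<open>D\<close> and \<open>E\<close> are affine in
  \<open>Y\<close>. For \<open>q = (1 - t) / (1 - t z)\<close> this coordinate is simply
  \<open>1 / (1 - t z)\<close>, and for \<open>q = 0\<close> it is the case
  \<open>t = 1\<close>.\<close>

lemma g_step_facts:
  fixes z q :: complex and g c :: real
  assumes z: "norm z < 1" and q: "norm q \<le> 1" and g: "0 < g" "g \<le> 1" and c: "c = 1 - g"
    and Y: "0 \<le> Re Y" and Y_def: "Y = (1 - z * q) / (1 - z)"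
    and D_def: "D = 1 - of_real c * z * q"
    and h: "h = of_real g / D"
    and E: "E = of_real c * Y + of_real g"
  shows "E \<noteq> 0" and "D \<noteq> 0" and "z \<noteq> 1" and "Y \<noteq> 0"
    and "(1 - z * h) / (1 - z) = E / D" and "D = E - of_real c * z * Y"
proof -
  show z1: "z \<noteq> 1"
    using z by auto
  have "0 \<le> c * Re Y"
    using Y g c by simp
  then have "Re E > 0"
    using g by (simp add: E)
  then show "E \<noteq> 0"
    by auto
  show D: "D \<noteq> 0"
    by (rule Re_pos_imp_nonzero) (simp only: D_def c less_le_trans[OF g(1) norm_g_denom_ge[OF z q g(2)]])
  have "norm z * norm q \<le> norm z * 1"
    using q by (intro mult_left_mono) auto
  then have "norm (z * q) < norm (1 :: complex)"
    using z by (simp add: norm_mult)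
  then have "z * q \<noteq> 1"
    by (intro notI) simp
  then show "Y \<noteq> 0"
    using z1 by (simp add: Y_def)
  have zq: "z * q = 1 - (1 - z) * Y"
    using z1 by (simp add: Y_def)
  have D_eq: "D = 1 - of_real c * (1 - (1 - z) * Y)"
    by (simp only: D_def mult.assoc zq)
  show "D = E - of_real c * z * Y"
    unfolding D_eq E c by (simp add: algebra_simps)
  have "(1 - z * h) * D = D - z * of_real g"
    using D by (simp add: h field_simps)
  also have "\<dots> = (1 - z) * E"
    unfolding D_eq E c by (simp add: algebra_simps)
  finally show "(1 - z * h) / (1 - z) = E / D"
    using z1 D by (simp add: field_simps)
qed

text \<open>Every sign is read off a reciprocal. The conditions feed each other in pairs:
  \<open>Im (z q)\<close> controls \<open>Im h\<close> and \<open>Im q\<close> controls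
  \<open>Im (z h)\<close>; likewise \<open>Im (z Y)\<close> controls \<open>Im (E / D)\<close> and
  \<open>Im Y\<close> controls \<open>Im (z E / D)\<close>. This is why the region lists both
  members of each pair.\<close>

lemma g_region_step:
  assumes z: "norm z < 1" "0 \<le> Im z" and g: "0 < g" "g \<le> 1" and q: "q \<in> g_region z"
  shows "of_real g / (1 - of_real (1 - g) * z * q) \<in> g_region z"
proof -
  define c where "c = 1 - g"
  define Y where "Y = (1 - z * q) / (1 - z)"
  define E where "E = of_real c * Y + of_real g"
  define D where "D = 1 - of_real c * z * q"
  define h where "h = of_real g / D"
  have c: "0 \<le> c"
    using g by (simp add: c_def)
  have q': "norm q \<le> 1" "0 \<le> Im q" "0 \<le> Im (z * q)" "0 \<le> Re Y" "0 \<le> Im Y" "0 \<le> Im (z * Y)"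
    using q by (auto simp: g_region_def Y_def)
  have f: "E \<noteq> 0" "D \<noteq> 0" "z \<noteq> 1" "Y \<noteq> 0" "(1 - z * h) / (1 - z) = E / D"
    "D = E - of_real c * z * Y"
    by (rule g_step_facts[OF z(1) q'(1) g c_def q'(4) Y_def D_def h_def E_def])+
  have P: "(norm h)\<^sup>2 \<le> Re h"
    using g_step_norm_power2_le_Re[OF z(1) q'(1) g] by (simp add: h_def D_def c_def)
  then have n: "norm h \<le> 1"
    by (rule norm_power2_le_Re_imp_norm_le)
  have "Im (inverse h) = - (c / g) * Im (z * q)"
    by (simp add: h_def D_def mult.assoc)
  also have "\<dots> \<le> 0"
    using c g q' by (simp add: divide_nonpos_pos mult_nonneg_nonneg)
  finally have Imh: "0 \<le> Im h"
    by (simp only: Im_inverse_le_0_iff)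
  have Imzh: "0 \<le> Im (z * h)"
  proof (cases "z = 0")
    case False
    then have "inverse (z * h) = of_real (inverse g) * (inverse z - of_real c * q)"
      using g f(2) by (simp add: h_def D_def field_simps)
    then have "Im (inverse (z * h)) = inverse g * (Im (inverse z) - c * Im q)"
      by (simp only: Im_of_real_mult minus_complex.sel)
    also have "\<dots> \<le> 0"
    proof (rule mult_nonneg_nonpos)
      have "Im (inverse z) \<le> 0" "0 \<le> c * Im q"
        using z c q' by (simp_all only: Im_inverse_le_0_iff mult_nonneg_nonneg)
      then show "Im (inverse z) - c * Im q \<le> 0"
        by linarith
    qed (use g in simp)
    finally show ?thesis
      by (simp only: Im_inverse_le_0_iff)
  qed simp
  have inv: "inverse (E / D) = 1 - z * (of_real c * Y / E)"
    using f by (simp add: field_simps)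
  \<comment> \<open>\<open>E\<close> is \<open>c Y\<close> moved right by \<open>g > 0\<close>, and
    \<open>c Y\<close> has nonnegative real part, so \<open>|c Y| <= |E|\<close>.\<close>
  have "0 \<le> Re (of_real c * Y)"
    using c q' by simp
  then have "(norm (of_real c * Y))\<^sup>2 \<le> (norm E)\<^sup>2"
    unfolding cmod_power2 E_def using g c q'(5) by (intro add_mono power_mono) auto
  then have "norm (of_real c * Y) \<le> norm E"
    by simp
  then have "norm (of_real c * Y / E) \<le> 1"
    using f by (simp add: norm_divide divide_le_eq_1)
  then have "norm (z * (of_real c * Y / E)) \<le> 1"
    unfolding norm_mult using z(1) by (intro mult_le_one) auto
  then have "0 \<le> Re (inverse (E / D))"
    unfolding inv using complex_Re_le_cmod[of "z * (of_real c * Y / E)"] by simp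
  then have ReY: "0 \<le> Re (E / D)"
    by (simp only: Re_inverse_ge_0_iff)
  have "0 \<le> Im (z * (of_real c * Y / E))"
  proof (cases "z = 0 \<or> c = 0")
    case False
    then have "inverse (z * (of_real c * Y / E)) = inverse z + of_real (g / c) * inverse (z * Y)"
      using f by (simp add: E_def field_simps)
    then have "Im (inverse (z * (of_real c * Y / E))) = Im (inverse z) + g / c * Im (inverse (z * Y))"
      by (simp only: plus_complex.sel Im_of_real_mult)
    also have "\<dots> \<le> 0"
      using q' z c g Im_inverse_le_0_iff[of z] Im_inverse_le_0_iff[of "z * Y"]
      by (intro add_nonpos_nonpos mult_nonneg_nonpos) auto
    finally show ?thesis
      by (simp only: Im_inverse_le_0_iff)
  qed auto
  then have "Im (inverse (E / D)) \<le> 0"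
    unfolding inv by simp
  then have ImY: "0 \<le> Im (E / D)"
    by (simp only: Im_inverse_le_0_iff)
  have ImzY: "0 \<le> Im (z * (E / D))"
  proof (cases "z = 0")
    case False
    then have "inverse (z * (E / D)) = inverse z - of_real c * Y / E"
      using f by (simp add: field_simps)
    also have "of_real c * Y / E = 1 - of_real g * inverse E"
      using f by (simp add: E_def field_simps)
    finally have "Im (inverse (z * (E / D))) = Im (inverse z) + g * Im (inverse E)"
      by simp
    also have "\<dots> \<le> 0"
    proof -
      have "0 \<le> Im E"
        using c q' by (simp add: E_def)
      then show ?thesis
        using z g Im_inverse_le_0_iff[of z] Im_inverse_le_0_iff[of E]
        by (intro add_nonpos_nonpos mult_nonneg_nonpos) auto
    qed
    finally show ?thesis
      by (simp only: Im_inverse_le_0_iff)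
  qed simp
  have "h \<in> g_region z"
    unfolding g_region_def mem_Collect_eq f(5) using n Imh Imzh ReY ImY ImzY by blast
  then show ?thesis
    by (simp add: h_def D_def c_def)
qed

text \<open>The bound is the limit for \<open>q = 0\<close> and \<open>z -> -1\<close>. Since
  \<open>1 / (1 - z h) = D / y\<close> with \<open>y = D - g z\<close>, the claim is
  \<open>|y|^2 <= (1 + g) Re (D * cnj y)\<close>, which amounts to
  \<open>g |z|^2 <= |D|^2 + c Re (D * cnj z)\<close>.\<close>

lemma Re_g_step_ge:
  assumes z: "norm z < 1" and q: "(norm q)\<^sup>2 \<le> Re q" and g: "0 < g" "g \<le> 1"
    and h: "h = of_real g / (1 - of_real (1 - g) * z * q)"
  shows "1 / (1 + g) \<le> Re (1 / (1 - z * h))"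
proof -
  define c where "c = 1 - g"
  define D where "D = 1 - of_real c * z * q"
  have q1: "norm (q - 1/2) \<le> 1/2"
    using q unfolding norm_power2_le_Re_iff .
  have "norm q \<le> 1"
    by (rule norm_power2_le_Re_imp_norm_le[OF q])
  then have "g \<le> Re D"
    unfolding D_def c_def by (intro norm_g_denom_ge) (use z g in auto)
  then have D0: "D \<noteq> 0"
    using g by auto
  have c: "0 \<le> c"
    using g by (simp add: c_def)
  have "norm (of_real c * z * (q - 1/2)) = c * (norm z * norm (q - 1/2))"
    using c by (simp add: norm_mult)
  also have "\<dots> \<le> c * (1 * (1/2))"
    using c q1 z by (intro mult_left_mono mult_mono) auto
  finally have "1 - c / 2 \<le> 1 - norm (of_real c * z * (q - 1/2))"
    by simp
  also have "\<dots> \<le> norm (1 - of_real c * z * (q - 1/2))"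
    using norm_triangle_ineq2[of 1 "of_real c * z * (q - 1/2)"] by simp
  \<comment> \<open>Because \<open>g + (c/2)^2 = ((1 + g)/2)^2\<close>, completing the square turns
    the required inequality into \<open>(1 + g)/2 * |z| <= |D + (c/2) z|\<close>. The shift by
    \<open>(c/2) z\<close> recentres \<open>q\<close> at 1/2, where the disc hypothesis
    applies.\<close>
  also have "1 - of_real c * z * (q - 1/2) = D + of_real (c / 2) * z"
    by (simp add: D_def algebra_simps)
  finally have le1: "1 - c / 2 \<le> norm (D + of_real (c / 2) * z)" .
  have "(1 + g) / 2 * norm z \<le> (1 + g) / 2 * 1"
    using g z by (intro mult_left_mono) auto
  also have "\<dots> \<le> norm (D + of_real (c / 2) * z)"
    using le1 by (simp add: c_def field_simps)
  finally have "((1 + g) / 2 * norm z)\<^sup>2 \<le> (norm (D + of_real (c / 2) * z))\<^sup>2"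
    using g by (intro power_mono) auto
  then have main: "g * (norm z)\<^sup>2 \<le> (norm D)\<^sup>2 + c * (Re D * Re z + Im D * Im z)"
    unfolding cmod_power2 c_def power_mult_distrib by (simp add: power2_eq_square field_simps)
  have y: "1 / (1 - z * h) = D / (D - of_real g * z)"
  proof -
    have "h = of_real g / D"
      by (simp add: h D_def c_def)
    then have "1 - z * h = (D - of_real g * z) / D"
      using D0 by (simp add: field_simps)
    then show ?thesis
      by simp
  qed
  define y where "y = D - of_real g * z"
  have "0 \<le> g * ((norm D)\<^sup>2 + c * (Re D * Re z + Im D * Im z) - g * (norm z)\<^sup>2)"
    using main g by simp
  also have "\<dots> = (1 + g) * (Re D * Re y + Im D * Im y) - (norm y)\<^sup>2"
    unfolding cmod_power2 y_def c_def by (simp add: power2_eq_square algebra_simps)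
  finally have le: "(norm y)\<^sup>2 \<le> (1 + g) * (Re D * Re y + Im D * Im y)"
    by simp
  have "y \<noteq> 0"
  proof
    assume "y = 0"
    then have "D = of_real g * z"
      by (simp add: y_def)
    then have "norm D < g"
      using z g by (simp add: norm_mult)
    then show False
      using \<open>g \<le> Re D\<close> complex_Re_le_cmod[of D] by linarith
  qed
  then have "1 / (1 + g) \<le> (Re D * Re y + Im D * Im y) / (norm y)\<^sup>2"
    using le g by (simp add: field_simps)
  also have "\<dots> = Re (D / y)"
    by (simp add: Re_divide cmod_power2)
  finally show ?thesis
    by (simp add: y y_def)
qed

text \<open>Here \<open>q\<close> and \<open>h\<close> stand for \<open>q_1\<close> and
  \<open>q_0\<close>. The link between \<open>v\<close> and \<open>q_1\<close> is
  \<open>1/v = 1 + ((1 - g)/g) Y\<close>: \<open>Re Y >= 0\<close> puts \<open>v\<close> in the disc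
  and \<open>Im Y >= 0\<close> gives \<open>Im v <= 0\<close>. As \<open>g < 1\<close> and
  \<open>Y\<close> is nonzero, \<open>v\<close> is not 1, which keeps \<open>m\<close> away from 1
  and \<open>u\<close> away from 0.\<close>

lemma Re_divide_ge:
  fixes a b d g :: real and z q h w v :: complex
  assumes z: "norm z < 1" "0 \<le> Im z" and g: "0 < g" "g < 1" and q: "q \<in> g_region z"
    and h: "h = of_real g / (1 - of_real (1 - g) * z * q)"
    and w: "w = 1 / (1 - z * h)" and v: "v = (1 - z) * w * h"
    and abd: "0 < a" "a \<le> b" "0 \<le> d"
    and A: "A = of_real a * w + of_real (b - a)"
    and u: "u = of_real b - of_real a * v + of_real d * h"
  shows "u \<noteq> 0" and "Re A / (b + d) \<le> Re (A / u)"
proof -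
  have q': "norm q \<le> 1" "0 \<le> Re ((1 - z * q) / (1 - z))" "0 \<le> Im ((1 - z * q) / (1 - z))"
    using q by (auto simp: g_region_def)
  define Y where "Y = (1 - z * q) / (1 - z)"
  define E where "E = of_real (1 - g) * Y + of_real g"
  define D where "D = 1 - of_real (1 - g) * z * q"
  have hD: "h = of_real g / D"
    by (simp add: h D_def)
  have g1: "g \<le> 1"
    using g by simp
  have f: "E \<noteq> 0" "D \<noteq> 0" "z \<noteq> 1" "Y \<noteq> 0" "(1 - z * h) / (1 - z) = E / D"
    by (rule g_step_facts[OF z(1) q'(1) g(1) g1 refl q'(2)[folded Y_def] Y_def D_def hD E_def])+
  have "h \<in> g_region z"
    unfolding h by (rule g_region_step[OF z g(1) g1 q])
  then have Imh: "0 \<le> Im h" and Imzh: "0 \<le> Im (z * h)"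
    by (auto simp: g_region_def)
  have h0: "h \<noteq> 0"
    using g f by (simp add: hD)
  have hP: "norm (h - 1/2) \<le> 1/2"
    unfolding norm_power2_le_Re_iff[symmetric] h
    by (rule g_step_norm_power2_le_Re) (use z q' g in auto)
  have "(norm h)\<^sup>2 \<le> Re h"
    using hP unfolding norm_power2_le_Re_iff[symmetric] .
  then have Reh: "0 < Re h"
    using h0 by (meson less_le_trans zero_less_norm_iff zero_less_power)
  \<comment> \<open>The disc is symmetric under \<open>x -> 1 - x\<close>.\<close>
  have hP': "norm (1 - h - 1/2) \<le> 1/2"
    using hP unfolding norm_power2_le_Re_iff[symmetric] cmod_power2
    by (simp add: power2_eq_square algebra_simps)
  have vE: "v = of_real g / E"
  proof -
    have "v = h / ((1 - z * h) / (1 - z))"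
      using f(3) by (simp add: v w)
    also have "\<dots> = of_real g / E"
      unfolding f(5) using f by (simp add: hD)
    finally show ?thesis .
  qed
  have v0: "v \<noteq> 0"
    using vE f g by simp
  have inv_v: "inverse v = 1 + of_real ((1 - g) / g) * Y"
    using f g by (simp add: vE E_def field_simps)
  have "1 \<le> Re (inverse v)"
    unfolding inv_v using g q' by (simp add: Y_def[symmetric])
  then have vP: "norm (v - 1/2) \<le> 1/2"
    using Re_inverse_ge_1_iff[OF v0] norm_power2_le_Re_iff by blast
  have Imv: "Im v \<le> 0"
  proof -
    have "0 \<le> Im (inverse v)"
      unfolding inv_v using g q' by (simp add: Y_def[symmetric])
    then have "Im (inverse (inverse v)) \<le> 0"
      by (simp only: Im_inverse_le_0_iff)
    then show ?thesis
      by simp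
  qed
  have v1: "v \<noteq> 1"
    using inv_v f g by auto
  \<comment> \<open>The disc meets the line \<open>Re = 1\<close> only in the point 1.\<close>
  have Rev: "Re v < 1"
  proof (rule ccontr)
    assume "\<not> Re v < 1"
    moreover have *: "(Re v)\<^sup>2 + (Im v)\<^sup>2 \<le> Re v"
      using vP unfolding norm_power2_le_Re_iff[symmetric] cmod_power2 .
    ultimately have "Re v \<le> (Re v)\<^sup>2"
      by (simp add: power2_eq_square)
    then have "(Im v)\<^sup>2 = 0" "(Re v)\<^sup>2 = Re v"
      using * zero_le_power2[of "Im v"] by linarith+
    then have "v = 1"
      using \<open>\<not> Re v < 1\<close> by (auto simp: complex_eq_iff power2_eq_square)
    then show False
      using v1 by simp
  qed
  define N where "N = b + d"
  have N: "0 < N"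
    using abd by (simp add: N_def)
  define m where "m = of_real (a / N) * v + of_real (d / N) * (1 - h)"
  have mN: "of_real N * m = of_real a * v + of_real d * (1 - h)"
    using N by (simp add: m_def distrib_left)
  have mP: "norm (m - 1/2) \<le> 1/2"
  proof -
    \<comment> \<open>The last term is the weight \<open>b - a\<close> placed at 0, seen from the
      centre 1/2; the three radii then add up to \<open>N / 2\<close>.\<close>
    from mN have "of_real N * (m - 1/2) =
        of_real a * (v - 1/2) + of_real d * ((1 - h) - 1/2) - of_real ((b - a) / 2)"
      by (simp add: N_def right_diff_distrib) (simp add: field_simps)
    then have "norm (of_real N * (m - 1/2)) \<le>
        norm (of_real a * (v - 1/2)) + norm (of_real d * ((1 - h) - 1/2)) +
        norm (of_real ((b - a) / 2) :: complex)"
      by (simp only:) (rule order.trans[OF norm_triangle_ineq4 add_right_mono[OF norm_triangle_ineq]])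
    also have "\<dots> \<le> a * (1/2) + d * (1/2) + (b - a) / 2"
      unfolding norm_mult norm_of_real using abd vP hP'
      by (intro add_mono mult_mono) auto
    also have "\<dots> = N * (1/2)"
      by (simp add: N_def field_simps)
    finally show ?thesis
      unfolding norm_mult norm_of_real using N by simp
  qed
  have Imm: "Im m \<le> 0"
  proof -
    have "a / N * Im v \<le> 0" "0 \<le> d / N * Im h"
      using Imv Imh abd N by (simp_all add: mult_nonneg_nonpos divide_nonpos_pos)
    then show ?thesis
      by (simp add: m_def)
  qed
  have "Re m < 1"
  proof -
    have "a * Re v < a"
      using abd Rev by simp
    moreover have "d * (1 - Re h) \<le> d"
      using abd Reh by (simp add: algebra_simps)
    ultimately have "a * Re v + d * (1 - Re h) < N"
      using abd unfolding N_def by linarith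
    then show ?thesis
      using N by (simp add: m_def field_simps)
  qed
  then have m1: "1 - m \<noteq> 0"
    by auto
  have uN: "u = of_real N * (1 - m)"
    using mN by (simp add: u right_diff_distrib N_def)
  show "u \<noteq> 0"
    using uN m1 N by simp
  have ReM: "0 \<le> Re (m / (1 - m))" and ImM: "Im (m / (1 - m)) \<le> 0"
  proof -
    \<comment> \<open>The disc inequality for \<open>m\<close> says exactly
      \<open>Re (m * cnj (1 - m)) >= 0\<close>. With \<open>Im m <= 0\<close> it puts
      \<open>m / (1 - m)\<close> in the closed fourth quadrant.\<close>
    have "(Re m)\<^sup>2 + (Im m)\<^sup>2 \<le> Re m"
      using mP unfolding norm_power2_le_Re_iff[symmetric] cmod_power2 .
    then have "0 \<le> Re m * Re (1 - m) + Im m * Im (1 - m)"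
      by (simp add: power2_eq_square algebra_simps)
    then show "0 \<le> Re (m / (1 - m))"
      unfolding Re_divide by (intro divide_nonneg_nonneg) auto
    show "Im (m / (1 - m)) \<le> 0"
      unfolding Im_divide using Imm by (intro divide_nonpos_nonneg) (auto simp: algebra_simps)
  qed
  have "norm h \<le> 1"
    using hP norm_power2_le_Re_imp_norm_le norm_power2_le_Re_iff by blast
  then have "norm z * norm h \<le> norm z * 1"
    by (intro mult_left_mono) auto
  then have "norm (z * h) < 1"
    using z by (simp add: norm_mult)
  then have "0 < Re (1 - z * h)"
    using complex_Re_le_cmod[of "z * h"] by simp
  then have Rew: "0 \<le> Re w"
    using Re_inverse_ge_0_iff[of "1 - z * h"] by (simp add: w divide_inverse)
  have Imw: "0 \<le> Im w"
    using Im_inverse_le_0_iff[of "inverse (1 - z * h)"] Imzh by (simp add: w divide_inverse)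
  have "A / u = A / of_real N + A * (m / (1 - m)) / of_real N"
    using m1 N by (simp add: uN field_simps)
  then have "Re (A / u) = Re A / N + Re (A * (m / (1 - m))) / N"
    by (simp only: plus_complex.sel Re_divide_of_real)
  moreover have "0 \<le> Re (A * (m / (1 - m)))"
  proof -
    have "0 \<le> Re A" "0 \<le> Im A"
      using Rew Imw abd by (simp_all add: A)
    then have "0 \<le> Re A * Re (m / (1 - m))" "Im A * Im (m / (1 - m)) \<le> 0"
      using ReM ImM by (auto intro: mult_nonneg_nonpos)
    then show ?thesis
      by (simp only: times_complex.sel)
  qed
  ultimately show "Re A / (b + d) \<le> Re (A / u)"
    using N by (simp add: N_def)
qed

text \<open>Truncations arise from 0, a point of the region, by finitely many steps that preserve
  it; closedness carries membership to the limit.\<close>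

lemma g_fraction_eval_in_g_region:
  assumes "g_fraction g q" and g: "\<And>k. 0 < g k" and z: "norm z < 1" "0 \<le> Im z"
  shows "eval_fps (q k) z \<in> g_region z"
proof (rule closed_sequentially[OF closed_g_region _ g_fraction_trunc_tendsto[OF assms(1) z(1)]])
  fix n
  show "eval_fps (g_fraction_trunc g n k) z \<in> g_region z"
  proof (induction n arbitrary: k)
    case 0
    show ?case
      using zero_in_g_region[OF z] by simp
  next
    case (Suc n)
    have "eval_fps (g_fraction_trunc g (Suc n) k) z =
        of_real (g k) / (1 - of_real (1 - g k) * z * eval_fps (g_fraction_trunc g n (Suc k)) z)"
      by (intro g_fraction_trunc_eval(2) g_fractionD[OF assms(1)] z(1))
    then show ?case
      using g_region_step[OF z g g_fractionD(2)[OF assms(1)] Suc.IH] by (simp only:)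
  qed
qed

text \<open>The truncations are built from real parameters by rational operations, so they commute
  with conjugation, and so does their limit.\<close>

lemma g_fraction_eval_cnj:
  assumes "g_fraction g q" and z: "norm z < 1"
  shows "eval_fps (q k) (cnj z) = cnj (eval_fps (q k) z)"
proof (rule LIMSEQ_unique)
  have z': "norm (cnj z) < 1"
    using z by simp
  show "(\<lambda>n. eval_fps (g_fraction_trunc g n k) (cnj z)) \<longlonglongrightarrow> eval_fps (q k) (cnj z)"
    by (rule g_fraction_trunc_tendsto[OF assms(1) z'])
  have "eval_fps (g_fraction_trunc g n k) (cnj z) = cnj (eval_fps (g_fraction_trunc g n k) z)" for n
  proof (induction n arbitrary: k)
    case (Suc n)
    show ?case
      using g_fraction_trunc_eval(2)[of g, OF g_fractionD(1,2)[OF assms(1)]] z z'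
      by (simp add: Suc.IH del: g_fraction_trunc.simps)
  qed simp
  then show "(\<lambda>n. eval_fps (g_fraction_trunc g n k) (cnj z)) \<longlonglongrightarrow> cnj (eval_fps (q k) z)"
    using tendsto_cnj[OF g_fraction_trunc_tendsto[OF assms(1) z, of k]] by simp
qed

lemma g_fraction_eval_step:
  assumes "g_fraction g q" and "0 < g k" and z: "norm z < 1"
  shows "eval_fps (q k) z = of_real (g k) / (1 - of_real (1 - g k) * z * eval_fps (q (Suc k)) z)"
proof -
  let ?D = "1 - of_real (1 - g k) * z * eval_fps (q (Suc k)) z"
  have "g k \<le> Re ?D"
    by (rule norm_g_denom_ge[OF z g_fraction_eval_norm_le[OF assms(1) z] g_fractionD(2)[OF assms(1)]])
  then have "?D \<noteq> 0"
    by (intro Re_pos_imp_nonzero) (use assms(2) in linarith)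
  moreover have "eval_fps (q k) z * ?D = of_real (g k)"
    using g_fraction_eval_eq[OF assms(1) z, of k] by (simp only: algebra_simps mult_1_left)
  ultimately show ?thesis
    by (simp add: field_simps)
qed

section \<open>Gauss's continued fraction\<close>

abbreviation hyp_fps :: "real \<Rightarrow> real \<Rightarrow> real \<Rightarrow> complex fps" where
  "hyp_fps a b c \<equiv> fps_hypergeo [of_real a, of_real b] [of_real c] 1"

lemma hyp_fps_nth:
  "fps_nth (hyp_fps a b c) n =
    of_real (pochhammer a n * pochhammer b n / (pochhammer c n * fact n))"
  by (simp add: pochhammer_of_real)

lemma hyp_fps_commute: "hyp_fps a b c = hyp_fps b a c"
  by (rule fps_ext) (simp add: mult.commute)

lemma hyp_fps_conv_radius:
  assumes "0 < a" and "0 < b" and "0 < c"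
  shows "fps_conv_radius (hyp_fps a b c) = 1"
  unfolding fps_conv_radius_def
proof (rule conv_radius_ratio_limit_nonzero)
  let ?f = "\<lambda>n. pochhammer a n * pochhammer b n / (pochhammer c n * fact n)"
  have pos: "0 < pochhammer a n" "0 < pochhammer b n" "0 < pochhammer c n" for n
    using assms by (simp_all add: pochhammer_pos)
  have "norm (fps_nth (hyp_fps a b c) n) / norm (fps_nth (hyp_fps a b c) (Suc n)) =
      (c + real n) * (real n + 1) / ((a + real n) * (b + real n))" for n
  proof -
    have "norm (fps_nth (hyp_fps a b c) n) = ?f n" for n
      unfolding hyp_fps_nth norm_of_real using pos[of n] by simp
    then have "norm (fps_nth (hyp_fps a b c) n) / norm (fps_nth (hyp_fps a b c) (Suc n)) = ?f n / ?f (Suc n)"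
      by (simp only:)
    also have "\<dots> = (c + real n) * (real n + 1) / ((a + real n) * (b + real n))"
    proof -
      have "a + n \<noteq> 0" "b + n \<noteq> 0" "c + n \<noteq> 0" "real n + 1 \<noteq> 0"
        using assms by auto
      then show ?thesis
        using pos[THEN less_imp_neq, of n]
        unfolding pochhammer_Suc fact_Suc of_nat_Suc by (simp add: divide_simps)
    qed
    finally show ?thesis .
  qed
  moreover have "(\<lambda>n. (c + real n) * (real n + 1) / ((a + real n) * (b + real n))) \<longlonglongrightarrow> 1"
    by real_asymp
  ultimately show "(\<lambda>n. norm (fps_nth (hyp_fps a b c) n) / norm (fps_nth (hyp_fps a b c) (Suc n))) \<longlonglongrightarrow> 1"
    by (simp only:)
qed (simp_all add: one_ereal_def)

section \<open>Contiguous relations and derivatives\<close>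

lemma pochhammer_mult_shift: "a * pochhammer (a + 1) n = pochhammer a n * (a + of_nat n)"
  by (metis pochhammer_Suc pochhammer_rec)

text \<open>This three-term relation, divided by its left side, becomes one step of the continued
  fraction.\<close>

lemma hyp_fps_contiguous:
  assumes "0 < c"
  shows "hyp_fps a b c = hyp_fps a (b + 1) (c + 1) -
    fps_const (of_real (a * (c - b) / (c * (c + 1)))) * (fps_X * hyp_fps (a + 1) (b + 1) (c + 2))"
    (is "?L = ?R")
proof (rule fps_ext)
  fix n
  show "fps_nth ?L n = fps_nth ?R n"
  proof (cases n)
    case 0
    then show ?thesis by simp
  next
    case (Suc m)
    \<comment> \<open>\<open>P\<close>, \<open>Q\<close>, \<open>R\<close> are factors common to the
      three coefficients of degree \<open>m + 1\<close>; without them a rational identity in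
      \<open>a, b, c, m\<close> remains.\<close>
    define P Q R where "P = pochhammer (a + 1) m" and "Q = pochhammer (b + 1) m"
      and "R = pochhammer (c + 2) m"
    have R: "0 < R"
      unfolding R_def using assms by (intro pochhammer_pos) simp
    have e: "pochhammer a (Suc m) = a * P" "pochhammer b (Suc m) = b * Q"
      "pochhammer (b + 1) (Suc m) = Q * (b + 1 + m)"
      "pochhammer (c + 1) (Suc m) = (c + 1) * R"
      by (simp_all only: P_def Q_def R_def pochhammer_rec[of a] pochhammer_rec[of b]
          pochhammer_Suc[of "b + 1"] pochhammer_rec[of "c + 1"] add.assoc one_add_one)
    have "pochhammer c (Suc m) * (c + 1 + m) = c * ((c + 1) * R)"
      unfolding e(4)[symmetric] by (simp add: pochhammer_rec[of c] pochhammer_Suc[of "c + 1"])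
    then have ec: "pochhammer c (Suc m) = c * ((c + 1) * R) / (c + 1 + m)"
      using assms by (simp add: field_simps)
    have "a * P * (b * Q) / (c * ((c + 1) * R) / (c + 1 + m) * fact (Suc m)) =
      a * P * (Q * (b + 1 + m)) / ((c + 1) * R * fact (Suc m)) -
      a * (c - b) / (c * (c + 1)) * (P * Q / (R * fact m))"
    proof -
      have "c + 1 + real m \<noteq> 0" "c + 1 \<noteq> 0" "c \<noteq> 0" "R \<noteq> 0" "(fact m :: real) \<noteq> 0" "real m + 1 \<noteq> 0"
        using assms R by auto
      then show ?thesis
        unfolding fact_Suc of_nat_Suc by (simp add: divide_simps) (simp add: algebra_simps)
    qed
    then have "of_real (a * P * (b * Q) / (c * ((c + 1) * R) / (c + 1 + m) * fact (Suc m))) =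
      (of_real (a * P * (Q * (b + 1 + m)) / ((c + 1) * R * fact (Suc m))) -
      of_real (a * (c - b) / (c * (c + 1))) * of_real (P * Q / (R * fact m)) :: complex)"
      by (simp only: of_real_diff of_real_mult)
    then show ?thesis
      unfolding Suc fps_sub_nth fps_mult_left_const_nth fps_X_mult_nth hyp_fps_nth e ec
      by (simp only: P_def Q_def R_def if_False nat.distinct diff_Suc_1)
  qed
qed

text \<open>In terms of F, G and \<open>K = h G\<close> it reads \<open>G - F = z h G\<close>, which
  is \<open>1/w = 1 - z h\<close>.\<close>

lemma hyp_fps_diff:
  assumes "0 < c"
  shows "hyp_fps (a + 1) b c - hyp_fps a b c =
    fps_X * (fps_const (of_real (b / c)) * hyp_fps (a + 1) (b + 1) (c + 1))" (is "?L = ?R")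
proof (rule fps_ext)
  fix n
  show "fps_nth ?L n = fps_nth ?R n"
  proof (cases n)
    case 0
    then show ?thesis by simp
  next
    case (Suc m)
    define P Q R where "P = pochhammer (a + 1) m" and "Q = pochhammer (b + 1) m"
      and "R = pochhammer (c + 1) m"
    have R: "0 < R"
      unfolding R_def using assms by (intro pochhammer_pos) simp
    have e: "pochhammer a (Suc m) = a * P" "pochhammer b (Suc m) = b * Q"
      "pochhammer (a + 1) (Suc m) = P * (a + 1 + m)" "pochhammer c (Suc m) = c * R"
      by (simp_all only: P_def Q_def R_def pochhammer_rec[of a] pochhammer_rec[of b] pochhammer_rec[of c]
          pochhammer_Suc[of "a + 1"])
    have "P * (a + 1 + m) * (b * Q) / (c * R * fact (Suc m)) - a * P * (b * Q) / (c * R * fact (Suc m)) =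
      b / c * (P * Q / (R * fact m))"
    proof -
      have "c \<noteq> 0" "R \<noteq> 0" "(fact m :: real) \<noteq> 0" "real m + 1 \<noteq> 0"
        using assms R by auto
      then show ?thesis
        unfolding fact_Suc of_nat_Suc by (simp add: divide_simps) (simp add: algebra_simps)
    qed
    then have "of_real (P * (a + 1 + m) * (b * Q) / (c * R * fact (Suc m))) -
        of_real (a * P * (b * Q) / (c * R * fact (Suc m))) =
        (of_real (b / c) * of_real (P * Q / (R * fact m)) :: complex)"
      by (simp only: flip: of_real_diff of_real_mult)
    then show ?thesis
      unfolding Suc fps_sub_nth fps_mult_left_const_nth fps_X_mult_nth hyp_fps_nth e
      by (simp only: P_def Q_def R_def if_False nat.distinct diff_Suc_1)
  qed
qed

lemma fps_deriv_hyp_fps: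
  assumes "0 < c"
  shows "fps_deriv (hyp_fps a b c) =
    fps_const (of_real (a * b / c)) * hyp_fps (a + 1) (b + 1) (c + 1)" (is "?L = ?R")
proof (rule fps_ext)
  fix n
  define P Q R where "P = pochhammer (a + 1) n" and "Q = pochhammer (b + 1) n"
    and "R = pochhammer (c + 1) n"
  have R: "0 < R"
    unfolding R_def using assms by (intro pochhammer_pos) simp
  have e: "pochhammer a (Suc n) = a * P" "pochhammer b (Suc n) = b * Q" "pochhammer c (Suc n) = c * R"
    by (simp_all only: P_def Q_def R_def pochhammer_rec[of a] pochhammer_rec[of b] pochhammer_rec[of c])
  have "real (Suc n) * (a * P * (b * Q) / (c * R * fact (Suc n))) = a * b / c * (P * Q / (R * fact n))"
  proof -
    have "c \<noteq> 0" "R \<noteq> 0" "(fact n :: real) \<noteq> 0" "real n + 1 \<noteq> 0"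
      using assms R by auto
    then show ?thesis
      unfolding fact_Suc of_nat_Suc by (simp add: divide_simps)
  qed
  then have "of_real (real (Suc n)) * of_real (a * P * (b * Q) / (c * R * fact (Suc n))) =
      (of_real (a * b / c) * of_real (P * Q / (R * fact n)) :: complex)"
    by (simp only: flip: of_real_mult)
  then show "fps_nth ?L n = fps_nth ?R n"
    unfolding fps_deriv_nth fps_mult_left_const_nth hyp_fps_nth e Suc_eq_plus1[symmetric]
    by (simp only: P_def Q_def R_def of_real_of_nat_eq)
qed

text \<open>Together with \<open>K = h G\<close> it makes \<open>G' / G\<close> a function of
  \<open>z\<close> and \<open>h\<close> alone, namely \<open>(b + d h) / (1 - z)\<close>.\<close>

lemma hyp_fps_deriv_contiguous:
  assumes "0 < c"
  shows "(1 - fps_X) * fps_deriv (hyp_fps (a + 1) b c) =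
    fps_const (of_real b) * hyp_fps (a + 1) b c +
    fps_const (of_real (1 + a - c)) * (fps_const (of_real (b / c)) * hyp_fps (a + 1) (b + 1) (c + 1))"
    (is "?L = ?R")
proof (rule fps_ext)
  fix n
  define P Q R where "P = pochhammer (a + 1) n" and "Q = pochhammer b n" and "R = pochhammer c n"
  have R: "0 < R"
    unfolding R_def using assms by (intro pochhammer_pos) simp
  have e: "pochhammer (a + 1) (Suc n) = P * (a + 1 + n)" "pochhammer b (Suc n) = Q * (b + n)"
    "pochhammer c (Suc n) = R * (c + n)"
    by (simp_all only: P_def Q_def R_def pochhammer_Suc)
  have sh: "b * pochhammer (b + 1) n = Q * (b + n)" "c * pochhammer (c + 1) n = R * (c + n)"
    by (simp_all only: Q_def R_def pochhammer_mult_shift)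
  let ?g = "P * Q / (R * fact n)"
  have nz: "c \<noteq> 0" "R \<noteq> 0" "(fact n :: real) \<noteq> 0" "real n + 1 \<noteq> 0" "c + n \<noteq> 0"
    using assms R by auto
  have k: "b / c * (P * pochhammer (b + 1) n / (pochhammer (c + 1) n * fact n)) = ?g * (b + n) / (c + n)"
  proof -
    have "b / c * (P * pochhammer (b + 1) n / (pochhammer (c + 1) n * fact n)) =
        P * (b * pochhammer (b + 1) n) / ((c * pochhammer (c + 1) n) * fact n)"
      by (simp add: mult_ac)
    then show ?thesis
      unfolding sh by (simp add: mult_ac)
  qed
  have g': "real (Suc n) * (P * (a + 1 + n) * (Q * (b + n)) / (R * (c + n) * fact (Suc n))) =
      ?g * ((a + 1 + n) * (b + n) / (c + n))"
    using nz unfolding fact_Suc of_nat_Suc by (simp add: divide_simps)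
  have "?g * ((a + 1 + n) * (b + n) / (c + n)) - n * ?g = b * ?g + (1 + a - c) * (?g * (b + n) / (c + n))"
  proof -
    \<comment> \<open>Split \<open>a + 1 + n\<close> as
      \<open>(c + n) + (1 + a - c)\<close>.\<close>
    have e': "(a + 1 + n) * (b + n) / (c + n) - n = b + (1 + a - c) * ((b + n) / (c + n))"
      using nz by (simp add: field_simps)
    have "x * ((a + 1 + n) * (b + n) / (c + n)) - n * x = b * x + (1 + a - c) * (x * (b + n) / (c + n))" for x :: real
    proof -
      have "x * ((a + 1 + n) * (b + n) / (c + n)) - n * x = x * ((a + 1 + n) * (b + n) / (c + n) - n)"
        by (simp only: right_diff_distrib mult.commute)
      also have "\<dots> = b * x + (1 + a - c) * (x * (b + n) / (c + n))"
        unfolding e' by (simp add: algebra_simps add_divide_distrib)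
      finally show ?thesis .
    qed
    then show ?thesis .
  qed
  then have *: "of_real (?g * ((a + 1 + n) * (b + n) / (c + n))) - of_real (n * ?g) =
      (of_real (b * ?g) + of_real (1 + a - c) * of_real (?g * (b + n) / (c + n)) :: complex)"
    by (simp only: flip: of_real_diff of_real_mult of_real_add)
  have "fps_nth ?L n = of_nat (Suc n) * fps_nth (hyp_fps (a + 1) b c) (Suc n) -
      of_nat n * fps_nth (hyp_fps (a + 1) b c) n"
    by (cases n) (simp_all add: left_diff_distrib del: fps_hypergeo_nth)
  also have "of_nat (Suc n) * fps_nth (hyp_fps (a + 1) b c) (Suc n) =
      of_real (real (Suc n) * (P * (a + 1 + n) * (Q * (b + n)) / (R * (c + n) * fact (Suc n))))"
    unfolding hyp_fps_nth e of_real_mult[of "real (Suc n)"] by (simp only: of_real_of_nat_eq)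
  also have "\<dots> = of_real (?g * ((a + 1 + n) * (b + n) / (c + n)))"
    by (simp only: g')
  also have "of_nat n * fps_nth (hyp_fps (a + 1) b c) n = of_real (n * ?g)"
    unfolding hyp_fps_nth of_real_mult[of "real n"] by (simp only: of_real_of_nat_eq P_def Q_def R_def)
  also note *
  also have "of_real (?g * (b + n) / (c + n)) =
      (of_real (b / c) * fps_nth (hyp_fps (a + 1) (b + 1) (c + 1)) n :: complex)"
    unfolding hyp_fps_nth of_real_mult[symmetric] k[symmetric] by (simp only: P_def)
  also have "of_real (b * ?g) = of_real b * fps_nth (hyp_fps (a + 1) b c) n"
    unfolding hyp_fps_nth of_real_mult[symmetric] by (simp only: P_def Q_def R_def)
  finally show "fps_nth ?L n = fps_nth ?R n"
    by (simp del: fps_hypergeo_nth)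
qed

text \<open>The ratio for \<open>(a, b, c)\<close> is followed by the one for \<open>(b + 1, a, c + 1)\<close>, because 2F1 is
  symmetric in its first two parameters.\<close>

fun gauss_q :: "real \<Rightarrow> real \<Rightarrow> real \<Rightarrow> nat \<Rightarrow> complex fps" where
  "gauss_q a b c 0 = fps_const (of_real (b / c)) * (hyp_fps a (b + 1) (c + 1) * inverse (hyp_fps a b c))"
| "gauss_q a b c (Suc k) = gauss_q (b + 1) a (c + 1) k"

text \<open>In closed form \<open>g_(2j) = (b + j) / (c + 2j)\<close> and
  \<open>g_(2j+1) = (a + j) / (c + 2j + 1)\<close>.\<close>

fun gauss_g :: "real \<Rightarrow> real \<Rightarrow> real \<Rightarrow> nat \<Rightarrow> real" where
  "gauss_g a b c 0 = b / c"
| "gauss_g a b c (Suc k) = gauss_g (b + 1) a (c + 1) k"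

lemma gauss_g_bounds:
  assumes "0 < a" and "0 < b" and "b \<le> c" and "a \<le> c + 1"
  shows "0 < gauss_g a b c k \<and> gauss_g a b c k \<le> 1"
  using assms
proof (induction k arbitrary: a b c)
  case (Suc k)
  show ?case
    using Suc.IH[of "b + 1" a "c + 1"] Suc.prems by simp
qed simp

lemma inverse_hyp_fps: "inverse (hyp_fps a b c) * hyp_fps a b c = 1"
  by (rule inverse_mult_eq_1) simp

text \<open>Only level 0 needs an argument, for arbitrary parameters; a later level is level 0 for
  shifted parameters, whose hypotheses are inherited.\<close>

lemma g_fraction_gauss:
  assumes "0 < a" and "0 < b" and "b \<le> c" and "a \<le> c + 1"
  shows "g_fraction (gauss_g a b c) (gauss_q a b c)"
proof -
  have "gauss_q a b c k = fps_const (of_real (gauss_g a b c k)) +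
      fps_const (of_real (1 - gauss_g a b c k)) * (fps_X * (gauss_q a b c k * gauss_q a b c (Suc k)))" for k
    using assms
  proof (induction k arbitrary: a b c)
    case 0
    define g s where "g = b / c" and "s = a / (c + 1)"
    define U V Z where "U = hyp_fps a b c" and "V = hyp_fps a (b + 1) (c + 1)"
      and "Z = hyp_fps (a + 1) (b + 1) (c + 2)"
    \<comment> \<open>Here \<open>s\<close> is \<open>g_1\<close>. That the coefficient factors as
      \<open>(1 - g_0) g_1\<close> is what gives Gauss's fraction Wall's form.\<close>
    have gs: "a * (c - b) / (c * (c + 1)) = (1 - g) * s"
      using 0 by (simp add: g_def s_def field_simps)
    have U: "U = V - fps_const (of_real (1 - g)) * (fps_const (of_real s) * (fps_X * Z))"
      using hyp_fps_contiguous[of c a b] 0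
      unfolding gs U_def V_def Z_def by (simp only: of_real_mult fps_const_mult[symmetric] mult.assoc)
    have q0: "gauss_q a b c 0 = fps_const (of_real g) * (V * inverse U)"
      by (simp only: gauss_q.simps g_def U_def V_def)
    have q1: "gauss_q a b c (Suc 0) = fps_const (of_real s) * (Z * inverse V)"
      by (simp only: gauss_q.simps s_def Z_def V_def hyp_fps_commute[of "b + 1"] add.assoc one_add_one)
    have iV: "inverse V * V = 1" and iU: "inverse U * U = 1"
      by (simp_all only: U_def V_def inverse_hyp_fps)
    have "fps_const (of_real (1 - g)) * (fps_X * (gauss_q a b c 0 * gauss_q a b c (Suc 0))) =
        fps_const (of_real g) * inverse U * (inverse V * V) *
        (fps_const (of_real (1 - g)) * (fps_const (of_real s) * (fps_X * Z)))"
      unfolding q0 q1 by (simp only: ac_simps)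
    also have "\<dots> = fps_const (of_real g) * inverse U * (V - U)"
      by (subst (3) U) (simp add: iV)
    also have "\<dots> = gauss_q a b c 0 - fps_const (of_real g) * (inverse U * U)"
      unfolding q0 by (simp only: right_diff_distrib ac_simps)
    finally show ?case
      by (simp add: iU g_def)
  next
    case (Suc k)
    show ?case
      using Suc.IH[of "b + 1" a "c + 1"] Suc.prems by simp
  qed
  then show ?thesis
    unfolding g_fraction_def using gauss_g_bounds[OF assms] less_imp_le by blast
qed

text \<open>For a primitive \<open>p\<close> of \<open>k\<close>, the product
  \<open>f * exp (- p)\<close> is constant, with a nonzero value at 0.\<close>

lemma linear_ode_nonzero:
  assumes f: "\<And>z. z \<in> ball 0 1 \<Longrightarrow> (f has_field_derivative k z * f z) (at z)"
    and k: "k holomorphic_on ball 0 1" and "f 0 \<noteq> 0" and z: "z \<in> ball 0 1"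
  shows "f z \<noteq> (0 :: complex)"
proof -
  obtain p where p: "\<And>z. z \<in> ball 0 1 \<Longrightarrow> (p has_field_derivative k z) (at z within ball 0 1)"
    using holomorphic_convex_primitive'[OF convex_ball open_ball k] by blast
  have "\<exists>c. \<forall>z\<in>ball 0 1. f z * exp (- p z) = c"
  proof (rule has_field_derivative_zero_constant[OF convex_ball])
    fix x :: complex assume x: "x \<in> ball 0 1"
    have "((\<lambda>z. f z * exp (- p z)) has_field_derivative
        k x * f x * exp (- p x) + exp (- p x) * (- k x) * f x) (at x within ball 0 1)"
      by (rule DERIV_mult[OF has_field_derivative_at_within[OF f[OF x]] DERIV_chain2[OF DERIV_exp DERIV_minus[OF p[OF x]]]])
    then show "((\<lambda>z. f z * exp (- p z)) has_field_derivative 0) (at x within ball 0 1)"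
      by (simp add: mult.commute mult.left_commute)
  qed
  then obtain c where c: "\<And>z. z \<in> ball 0 1 \<Longrightarrow> f z * exp (- p z) = c"
    by blast
  have "c \<noteq> 0"
    using c[of 0] \<open>f 0 \<noteq> 0\<close> by auto
  then show ?thesis
    using c[OF z] by auto
qed

section \<open>The order of convexity\<close>

text \<open>For \<open>Im z < 0\<close> the estimate is applied at \<open>cnj z\<close>:
  \<open>h\<close>, \<open>w\<close>, \<open>A\<close> and \<open>u\<close> are all conjugated
  there, and the real parts stay the same.\<close>

lemma g_fraction_convexity_bound:
  fixes a b d :: real
  assumes q: "g_fraction g q" and g: "\<And>k. 0 < g k" "g 0 < 1" and z: "norm z < 1"
    and abd: "0 < a" "a \<le> b" "0 \<le> d"
    and h: "h = eval_fps (q 0) z" and w: "w = 1 / (1 - z * h)"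
    and A: "A = of_real a * w + of_real (b - a)"
    and u: "u = of_real b - of_real a * ((1 - z) * w * h) + of_real d * h"
  shows "u \<noteq> 0" and "Re A / (b + d) \<le> Re (A / u)" and "1 / (1 + g 0) \<le> Re w"
proof -
  have "u \<noteq> 0 \<and> Re A / (b + d) \<le> Re (A / u)"
  proof (cases "0 \<le> Im z")
    case True
    show ?thesis
      using Re_divide_ge[OF z True g(1)[of 0] g(2) g_fraction_eval_in_g_region[OF q g(1) z True, of "Suc 0"]
          g_fraction_eval_step[OF q g(1) z, of 0, folded h] w refl abd A u] by blast
  next
    case False
    have z': "norm (cnj z) < 1" "0 \<le> Im (cnj z)"
      using z False by auto
    have h': "cnj h = of_real (g 0) / (1 - of_real (1 - g 0) * cnj z * eval_fps (q (Suc 0)) (cnj z))"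
      unfolding h g_fraction_eval_cnj[OF q z, symmetric] by (rule g_fraction_eval_step[OF q g(1) z'(1)])
    have w': "cnj w = 1 / (1 - cnj z * cnj h)"
      by (simp add: w)
    have A': "cnj A = of_real a * cnj w + of_real (b - a)"
      by (simp add: A)
    have u': "cnj u = of_real b - of_real a * ((1 - cnj z) * cnj w * cnj h) + of_real d * cnj h"
      by (simp add: u)
    have "cnj u \<noteq> 0 \<and> Re (cnj A) / (b + d) \<le> Re (cnj A / cnj u)"
      using Re_divide_ge[OF z' g(1)[of 0] g(2) g_fraction_eval_in_g_region[OF q g(1) z', of "Suc 0"]
          h' w' refl abd A' u'] by blast
    then show ?thesis
      by (simp flip: complex_cnj_divide)
  qed
  then show "u \<noteq> 0" and "Re A / (b + d) \<le> Re (A / u)"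
    by blast+
  \<comment> \<open>\<open>q_1\<close> is itself a step applied to \<open>q_2\<close>, so it lies in
    the disc in either half-plane.\<close>
  have "(norm (eval_fps (q (Suc 0)) z))\<^sup>2 \<le> Re (eval_fps (q (Suc 0)) z)"
    unfolding g_fraction_eval_step[OF q g(1) z, of "Suc 0"]
    by (intro g_step_norm_power2_le_Re z g g_fraction_eval_norm_le[OF q] g_fractionD(2)[OF q])
  then show "1 / (1 + g 0) \<le> Re w"
    unfolding w
    by (rule Re_g_step_ge[OF z _ g(1) g_fractionD(2)[OF q] g_fraction_eval_step[OF q g(1) z, of 0, folded h]])
qed

lemma hyp_ratio_convexity_pointwise:
  fixes a b c :: real
  assumes abc: "0 < a" "a \<le> b" "a + b + 1 / 2 \<le> c" "c \<le> 1 + a" and z: "z \<in> ball 0 1"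
  shows "(3 * a - b - c) / 2 + (b - a) / (1 + a + b - c)
      + a * c * (2 * (c - a - b) - 1) / ((b + c) * (1 + a + b - c)) \<le>
    1 + Re (z * (deriv ^^ 2) (hyp_ratio a b c) z / deriv (hyp_ratio a b c) z)"
proof -
  define q g where "q = gauss_q (a + 1) b c" and "g = gauss_g (a + 1) b c"
  define Kf where "Kf = fps_const (of_real (b / c)) * hyp_fps (a + 1) (b + 1) (c + 1)"
  define F G K h where "F = eval_fps (hyp_fps a b c)" and "G = eval_fps (hyp_fps (a + 1) b c)"
    and "K = eval_fps Kf" and "h = eval_fps (q 0)"
  define d where "d = 1 + a - c"
  have pos: "0 < a + 1" "0 < b" "0 < c" "b < c" "0 \<le> d"
    using abc by (auto simp: d_def)
  have q: "g_fraction g q"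
    unfolding g_def q_def by (rule g_fraction_gauss) (use abc in auto)
  have g: "0 < g k" for k
    unfolding g_def using gauss_g_bounds[of "a + 1" b c k] abc by auto
  have g0: "g 0 = b / c" "g 0 < 1"
    using pos by (simp_all add: g_def)
  have RF: "1 \<le> fps_conv_radius (hyp_fps a b c)" and RG: "1 \<le> fps_conv_radius (hyp_fps (a + 1) b c)"
    and RK': "1 \<le> fps_conv_radius (hyp_fps (a + 1) (b + 1) (c + 1))"
    by (rule eq_refl[OF sym[OF hyp_fps_conv_radius]]; use abc in simp)+
  have RK: "1 \<le> fps_conv_radius Kf"
    unfolding Kf_def by (rule order.trans[OF _ fps_conv_radius_mult]) (use RK' in simp)
  have Rq: "1 \<le> fps_conv_radius (q 0)"
    by (rule g_fraction_conv_radius[OF q])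
  have R: "ereal (norm x) < fps_conv_radius (hyp_fps a b c)"
    "ereal (norm x) < fps_conv_radius (hyp_fps (a + 1) b c)"
    "ereal (norm x) < fps_conv_radius Kf"
    "ereal (norm x) < fps_conv_radius (q 0)" if "x \<in> ball 0 1" for x
  proof -
    have n: "norm x < 1"
      using that by simp
    show "ereal (norm x) < fps_conv_radius (hyp_fps a b c)"
      "ereal (norm x) < fps_conv_radius (hyp_fps (a + 1) b c)"
      "ereal (norm x) < fps_conv_radius Kf"
      "ereal (norm x) < fps_conv_radius (q 0)"
      by (rule less_fps_conv_radius[OF _ n], rule RF RG RK Rq)+
  qed
  \<comment> \<open>The division by G takes place among power series, so \<open>h\<close> is
    available on the whole disc before zeros of G are excluded.\<close>
  have qK: "Kf = q 0 * hyp_fps (a + 1) b c"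
    unfolding q_def Kf_def gauss_q.simps mult.assoc inverse_hyp_fps by simp
  have K: "K x = h x * G x" if "x \<in> ball 0 1" for x
    unfolding K_def h_def G_def qK by (rule eval_fps_mult) (rule R[OF that])+
  have F: "F x = G x * (1 - x * h x)" if x: "x \<in> ball 0 1" for x
  proof -
    have "G x - F x = eval_fps (hyp_fps (a + 1) b c - hyp_fps a b c) x"
      unfolding G_def F_def by (rule eval_fps_diff[symmetric]) (rule R[OF x])+
    also have "\<dots> = eval_fps (fps_X * Kf) x"
      using hyp_fps_diff[of c a b] pos by (simp only: Kf_def)
    also have "\<dots> = x * K x"
      unfolding K_def by (subst eval_fps_mult) (use R[OF x] in simp_all)
    finally show ?thesis
      by (simp add: K[OF x] algebra_simps)
  qed
  have dF: "(F has_field_derivative of_real a * (h x * G x)) (at x)" if x: "x \<in> ball 0 1" for x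
  proof -
    have "fps_deriv (hyp_fps a b c) = fps_const (of_real a) * Kf"
      using fps_deriv_hyp_fps[of c a b] pos by (simp add: Kf_def flip: mult.assoc)
    then have "eval_fps (fps_deriv (hyp_fps a b c)) x = of_real a * K x"
      unfolding K_def using R[OF x] by (simp add: eval_fps_mult)
    then show ?thesis
      using has_field_derivative_eval_fps[OF R(1)[OF x], of UNIV] unfolding F_def by (simp add: K[OF x])
  qed
  have dG: "(G has_field_derivative (of_real b + of_real d * h x) / (1 - x) * G x) (at x)"
    if x: "x \<in> ball 0 1" for x
  proof -
    let ?G' = "fps_deriv (hyp_fps (a + 1) b c)"
    have RG': "ereal (norm x) < fps_conv_radius ?G'"
      by (rule less_le_trans[OF R(2)[OF x] fps_conv_radius_deriv])
    have "(1 - x) * eval_fps ?G' x = eval_fps ((1 - fps_X) * ?G') x"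
    proof -
      have "ereal (norm x) < fps_conv_radius (1 - fps_X :: complex fps)"
        by (rule less_le_trans[OF _ fps_conv_radius_diff]) simp
      then show ?thesis
        using RG' by (simp add: eval_fps_mult eval_fps_diff)
    qed
    also have "(1 - fps_X) * ?G' = fps_const (of_real b) * hyp_fps (a + 1) b c + fps_const (of_real d) * Kf"
      using hyp_fps_deriv_contiguous[of c a b] pos by (simp only: Kf_def d_def)
    also have "eval_fps \<dots> x = of_real b * G x + of_real d * K x"
      unfolding G_def K_def using R[OF x]
      by (simp add: eval_fps_add eval_fps_mult less_fps_conv_radius_mult)
    finally have "(1 - x) * eval_fps ?G' x = (of_real b + of_real d * h x) * G x"
      by (simp add: K[OF x] algebra_simps)
    moreover have "1 - x \<noteq> 0"
      using x by auto
    ultimately have "eval_fps ?G' x = (of_real b + of_real d * h x) / (1 - x) * G x"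
      by (simp add: field_simps)
    then show ?thesis
      using has_field_derivative_eval_fps[OF R(2)[OF x], of UNIV] unfolding G_def by simp
  qed
  have hol_h: "h holomorphic_on ball 0 1"
    unfolding h_def by (rule holomorphic_on_eval_fps) (use R in \<open>auto simp: eball_def\<close>)
  have nz1: "1 - x \<noteq> 0" if "x \<in> ball 0 1" for x :: complex
    using that by auto
  have Gnz: "G x \<noteq> 0" if "x \<in> ball 0 1" for x
  proof (rule linear_ode_nonzero[OF dG _ _ that])
    show "(\<lambda>x. (of_real b + of_real d * h x) / (1 - x)) holomorphic_on ball 0 1"
      by (intro holomorphic_intros hol_h nz1)
    show "G 0 \<noteq> 0"
      by (simp add: G_def eval_fps_at_0)
  qed
  have hnz: "1 - x * h x \<noteq> 0" if x: "x \<in> ball 0 1" for x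
  proof -
    have "norm (x * h x) \<le> norm x * 1"
      unfolding norm_mult h_def using x by (intro mult_left_mono g_fraction_eval_norm_le[OF q]) auto
    then have "norm (x * h x) < norm (1 :: complex)"
      using x by simp
    then show ?thesis
      by auto
  qed
  define W where "W x = 1 / (1 - x * h x)" for x
  have ratio: "hyp_ratio a b c x = W x" if x: "x \<in> ball 0 1" for x
  proof -
    have "hyp_ratio a b c x = G x / F x"
      by (simp add: hyp_ratio_def hyp2F1_eq_eval_fps_hypergeo F_def G_def)
    then show ?thesis
      using Gnz[OF x] by (simp add: F[OF x] W_def)
  qed
  define A where "A x = of_real a * W x + of_real (b - a)" for x
  define u where "u x = of_real b - of_real a * ((1 - x) * W x * h x) + of_real d * h x" for x
  have Wh: "W x - 1 = x * W x * h x" if "x \<in> ball 0 1" for x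
    using hnz[OF that] by (simp add: W_def field_simps)
  have dW: "(W has_field_derivative W x * u x / (1 - x)) (at x)" if x: "x \<in> ball 0 1" for x
  proof -
    have Fnz: "F x \<noteq> 0"
      using F[OF x] Gnz[OF x] hnz[OF x] by simp
    have "((\<lambda>x. G x / F x) has_field_derivative
        ((of_real b + of_real d * h x) / (1 - x) * G x * F x - G x * (of_real a * (h x * G x))) / (F x * F x))
        (at x)"
      by (rule DERIV_divide[OF dG[OF x] dF[OF x] Fnz])
    also have "((of_real b + of_real d * h x) / (1 - x) * G x * F x - G x * (of_real a * (h x * G x))) /
        (F x * F x) = W x * u x / (1 - x)"
    proof -
      have "W x = G x / F x"
        using Gnz[OF x] by (simp add: F[OF x] W_def)
      then have GF: "G x = W x * F x"
        using Fnz by simp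
      show ?thesis
        unfolding GF u_def using Fnz nz1[OF x] by (simp add: field_simps)
    qed
    finally show ?thesis
      by (rule has_field_derivative_transform_within_open[OF _ open_ball x])
         (use ratio in \<open>simp add: hyp_ratio_def hyp2F1_eq_eval_fps_hypergeo F_def G_def\<close>)
  qed
  \<comment> \<open>After multiplication by \<open>x\<close>, the function \<open>h\<close> occurs
    only in \<open>x W h = W - 1\<close> and disappears. Differentiating the result gives the second
    derivative of \<open>W\<close> without any derivative of \<open>h\<close>.\<close>
  have riccati: "(1 - x) * (x * (W x * u x / (1 - x))) = of_real b * x * W x + of_real d * (W x - 1) -
      of_real a * ((1 - x) * (W x * (W x - 1)))" if x: "x \<in> ball 0 1" for x
    unfolding Wh[OF x] u_def using nz1[OF x] by (simp add: field_simps)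
  have holW: "W holomorphic_on ball 0 1"
    unfolding holomorphic_on_open[OF open_ball] using dW by blast
  have derivW: "deriv W x = W x * u x / (1 - x)" if "x \<in> ball 0 1" for x
    by (rule DERIV_imp_deriv[OF dW[OF that]])
  define W1 W2 where "W1 = deriv W z" and "W2 = deriv (deriv W) z"
  have dW1: "(W has_field_derivative W1) (at z)"
    using dW[OF z] derivW[OF z] by (simp add: W1_def)
  have dW2: "(deriv W has_field_derivative W2) (at z)"
    unfolding W2_def
    by (intro holomorphic_derivI[OF _ open_ball z] holomorphic_deriv[OF holW open_ball])
  have "((\<lambda>x. (1 - x) * (x * deriv W x)) has_field_derivative
      (1 - z) * (z * W2) + (1 - 2 * z) * W1) (at z)"
    by (rule derivative_eq_intros dW2 refl)+ (simp add: W1_def algebra_simps)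
  moreover have "((\<lambda>x. (1 - x) * (x * deriv W x)) has_field_derivative
      of_real b * (W z + z * W1) + of_real d * W1 +
      of_real a * (W z * (W z - 1)) - of_real a * ((1 - z) * ((2 * W z - 1) * W1))) (at z)"
  proof (rule has_field_derivative_transform_within_open[OF _ open_ball z])
    show "((\<lambda>x. of_real b * x * W x + of_real d * (W x - 1) - of_real a * ((1 - x) * (W x * (W x - 1))))
        has_field_derivative of_real b * (W z + z * W1) + of_real d * W1 +
        of_real a * (W z * (W z - 1)) - of_real a * ((1 - z) * ((2 * W z - 1) * W1))) (at z)"
      by (rule derivative_eq_intros dW1 refl)+ (simp add: algebra_simps)
  qed (simp only: derivW riccati)
  ultimately have second: "(1 - z) * (z * W2) + (1 - 2 * z) * W1 =
      of_real b * (W z + z * W1) + of_real d * W1 +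
      of_real a * (W z * (W z - 1)) - of_real a * ((1 - z) * ((2 * W z - 1) * W1))"
    by (rule DERIV_unique)
  have z': "norm z < 1"
    using z by simp
  note bound = g_fraction_convexity_bound[OF q g g0(2) z' abc(1,2) pos(5) fun_cong[OF h_def]
      W_def A_def u_def]
  have Wnz: "W z \<noteq> 0"
    using hnz[OF z] by (simp add: W_def)
  have W1_eq: "W1 * (1 - z) = W z * u z"
    using derivW[OF z] nz1[OF z] by (simp add: W1_def)
  have W1nz: "W1 \<noteq> 0"
    using W1_eq Wnz bound(1) by auto
  have "z * W2 / W1 = A z / u z - of_real a * (2 * W z - 1) + (of_real b * z + of_real d - 1 + 2 * z) / (1 - z)"
  proof -
    \<comment> \<open>Origin of \<open>A\<close>: the terms free of \<open>W1\<close> are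
      \<open>b W + a W (W - 1) = A W\<close>, and division by \<open>W1 (1 - z) = W u\<close> leaves
      \<open>A / u\<close>.\<close>
    have *: "(1 - z) * (z * W2) = A z * W z +
        W1 * (of_real b * z + of_real d - 1 + 2 * z - of_real a * ((1 - z) * (2 * W z - 1)))"
      using second by (simp add: A_def algebra_simps)
    have "z * W2 / W1 = (1 - z) * (z * W2) / (W1 * (1 - z))"
      using W1nz nz1[OF z] by simp
    also have "\<dots> = A z * W z / (W1 * (1 - z)) +
        (of_real b * z + of_real d - 1 + 2 * z - of_real a * ((1 - z) * (2 * W z - 1))) / (1 - z)"
      unfolding * add_divide_distrib using W1nz by simp
    also have "A z * W z / (W1 * (1 - z)) = A z / u z"
      unfolding W1_eq using Wnz by simp
    finally show ?thesis
      using nz1[OF z] by (simp add: diff_divide_distrib)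
  qed
  also have "(of_real b * z + of_real d - 1 + 2 * z) / (1 - z) =
      of_real (b + d + 1) * inverse (1 - z) - of_real (b + 2)"
    using nz1[OF z] by (simp add: field_simps)
  finally have "Re (z * W2 / W1) = Re (A z / u z - of_real a * (2 * W z - 1) +
      (of_real (b + d + 1) * inverse (1 - z) - of_real (b + 2)))"
    by (rule arg_cong)
  moreover have "Re (of_real r * x) = r * Re x" for r x
    by simp
  ultimately have eq: "Re (z * W2 / W1) =
      Re (A z / u z) - a * (2 * Re (W z) - 1) + ((b + d + 1) * Re (inverse (1 - z)) - (b + 2))"
    by (simp only: minus_complex.sel plus_complex.sel Re_complex_of_real) simp
  have half: "1 / 2 \<le> Re (inverse (1 - z))"
  proof -
    have "(Re z)\<^sup>2 + (Im z)\<^sup>2 \<le> 1"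
      using z' by (simp add: cmod_power2[symmetric] power_le_one)
    moreover have "0 < (1 - Re z)\<^sup>2 + (Im z)\<^sup>2"
      using nz1[OF z] by (simp add: complex_neq_0[of "1 - z", simplified])
    ultimately have "1 / 2 \<le> (1 - Re z) / ((1 - Re z)\<^sup>2 + (Im z)\<^sup>2)"
      by (simp add: field_simps power2_eq_square)
    then show ?thesis
      by simp
  qed
  define N where "N = b + d"
  have N: "0 < N" "N \<le> 1 / 2" "1 + a + b - c = N"
    using abc pos by (auto simp: N_def d_def)
  \<comment> \<open>This is the total coefficient of \<open>Re w\<close>, from
    \<open>Re A / N\<close> and from \<open>- 2 a Re w\<close>; \<open>N <= 1/2\<close> makes it
    nonnegative, so the lower bound for \<open>Re w\<close> may be inserted.\<close>
  have "(a * (1 - 2 * N) / N) * (c / (b + c)) \<le> (a * (1 - 2 * N) / N) * Re (W z)"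
  proof (rule mult_left_mono)
    have "c / (b + c) = 1 / (1 + g 0)"
      using pos by (simp add: g0 field_simps)
    then show "c / (b + c) \<le> Re (W z)"
      using bound(3) by simp
  qed (use abc N in simp)
  moreover have "a * c * (2 * (c - a - b) - 1) / ((b + c) * N) = (a * (1 - 2 * N) / N) * (c / (b + c))"
  proof -
    have "2 * (c - a - b) - 1 = 1 - 2 * N"
      using N(3) by simp
    then show ?thesis
      by (simp add: mult_ac)
  qed
  moreover have "(a * (1 - 2 * N) / N) * Re (W z) + (b - a) / N = Re (A z) / N - 2 * a * Re (W z)"
    using N by (simp add: A_def field_simps)
  moreover have "(b + d + 1) * (1 / 2) \<le> (b + d + 1) * Re (inverse (1 - z))"
    using half pos by (intro mult_left_mono) auto
  moreover have "(3 * a - b - c) / 2 = (b + d + 1) * (1 / 2) + a - b - 1"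
    by (simp add: d_def field_simps)
  ultimately have "(3 * a - b - c) / 2 + (b - a) / N + a * c * (2 * (c - a - b) - 1) / ((b + c) * N) \<le>
      1 + Re (z * W2 / W1)"
    using bound(2) unfolding eq N_def[symmetric] by (simp only: algebra_simps)
  \<comment> \<open>The ratio is known to equal \<open>W\<close> only in the disc; agreement near
    \<open>z\<close> is enough to transfer both derivatives.\<close>
  moreover have "\<forall>\<^sub>F x in nhds z. hyp_ratio a b c x = W x"
    using eventually_nhds_in_open[OF open_ball z] by eventually_elim (rule ratio)
  then have "deriv (hyp_ratio a b c) z = W1" "(deriv ^^ 2) (hyp_ratio a b c) z = W2"
    using higher_deriv_cong_ev[of "hyp_ratio a b c" W z z 2] deriv_cong_ev[of "hyp_ratio a b c" W z z]
    by (simp_all add: W1_def W2_def numeral_2_eq_2)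
  ultimately show ?thesis
    unfolding N(3) by simp
qed

theorem theorem1p2:
  fixes a b c :: real
  assumes "0 < a" and "a \<le> b"
    and "a + b + 1 / 2 \<le> c" and "c \<le> 1 + a"
  shows "hyp_ratio_convexity a b c \<ge>
    ereal ((3 * a - b - c) / 2 + (b - a) / (1 + a + b - c)
      + a * c * (2 * (c - a - b) - 1) / ((b + c) * (1 + a + b - c)))"
    (is "_ \<ge> ereal ?R")
proof -
  have "ereal (?R - 1) \<le> (INF z \<in> ball 0 1.
      ereal (Re (z * (deriv ^^ 2) (hyp_ratio a b c) z / deriv (hyp_ratio a b c) z)))"
    using hyp_ratio_convexity_pointwise[OF assms] by (intro INF_greatest) (simp add: algebra_simps)
  then have "1 + ereal (?R - 1) \<le> hyp_ratio_convexity a b c"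
    unfolding hyp_ratio_convexity_def order_of_convexity_def by (rule add_left_mono)
  moreover have "1 + ereal (?R - 1) = ereal ?R"
    by (simp only: one_ereal_def plus_ereal.simps add.commute[of 1] diff_add_cancel)
  ultimately show ?thesis
    by (simp only:)
qed

end
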